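(* Let $R$ be a commutative ring with identity, let $\varphi\colon G\to G_1$ be a homomorphism of finite groups with $K=\ker\varphi$, let $V$ be an $RG$-module and let $V_1$ be an $RG_1$-module. (1) There is an isomorphism of $R$-modules $\mathrm{Hom}_{RG_1}(\mathrm{Ind}_\varphi V,V_1)\cong \mathrm{Hom}_{RG}(V,\mathrm{Res}_\varphi V_1)$. (2) If furthermore $\mathrm{Res}^G_K V$ is relatively $1$-projective, then there is an isomorphism of $R$-modules $\mathrm{Hom}_{RG_1}(V_1,\mathrm{Ind}_\varphi V)\cong \mathrm{Hom}_{RG}(\mathrm{Res}_\varphi V_1,V)$.
   Context: Modules are left modules. For a homomorphism $\varphi\colon G\to G_1$ of finite groups (not necessarily injective), $RG_1$ is viewed as a left or right $RG$-module via $\varphi$. For an $RG$-module $V$, the non-injective induction is the $RG_1$-module $\mathrm{Ind}_\varphi V = RG_1\otimes_{RG}V$. For an $RG_1$-module $V_1$, the non-injective restriction $\mathrm{Res}_\varphi V_1$ is $V_1$ viewed as an $RG$-module with $g\in G$ acting as $\varphi(g)$. For a subgroup $K\le G$, $\mathrm{Res}^G_K$ is the usual restriction of modules from $RG$ to $RK$. For a finite group $K$, an $RK$-module is relatively $1$-projective if it is isomorphic to a direct summand of the $RK$-module $RK\otimes_R V_0$ for some $R$-module $V_0$. *)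

theory Defs
  imports
    "HOL-Algebra.AbelCoset"
    "HOL-Algebra.Free_Abelian_Groups"
    "HOL-Algebra.Generated_Groups"
    "HOL-Algebra.Module"
begin

text \<open>
  Modules use the library record \<open>module\<close>.  The library locale \<open>module\<close> requires a
  commutative ring of scalars; the following locale has the same axioms over an arbitrary ring.
  The fields \<open>mult\<close> and \<open>one\<close> that the record inherits from \<open>ring\<close> play no role in a module.
\<close>

locale left_module = A?: ring A + M?: abelian_group M
    for A :: "('a, 'c) ring_scheme" (structure) and M :: "('a, 'm, 'd) module_scheme" (structure) +
  assumes smult_closed [simp, intro]:
      "\<lbrakk>a \<in> carrier A; x \<in> carrier M\<rbrakk> \<Longrightarrow> a \<odot>\<^bsub>M\<^esub> x \<in> carrier M"
    and smult_l_distr: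
      "\<lbrakk>a \<in> carrier A; b \<in> carrier A; x \<in> carrier M\<rbrakk>
        \<Longrightarrow> (a \<oplus> b) \<odot>\<^bsub>M\<^esub> x = a \<odot>\<^bsub>M\<^esub> x \<oplus>\<^bsub>M\<^esub> b \<odot>\<^bsub>M\<^esub> x"
    and smult_r_distr:
      "\<lbrakk>a \<in> carrier A; x \<in> carrier M; y \<in> carrier M\<rbrakk>
        \<Longrightarrow> a \<odot>\<^bsub>M\<^esub> (x \<oplus>\<^bsub>M\<^esub> y) = a \<odot>\<^bsub>M\<^esub> x \<oplus>\<^bsub>M\<^esub> a \<odot>\<^bsub>M\<^esub> y"
    and smult_assoc1:
      "\<lbrakk>a \<in> carrier A; b \<in> carrier A; x \<in> carrier M\<rbrakk>
        \<Longrightarrow> (a \<otimes> b) \<odot>\<^bsub>M\<^esub> x = a \<odot>\<^bsub>M\<^esub> (b \<odot>\<^bsub>M\<^esub> x)"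
    and smult_one [simp]:
      "x \<in> carrier M \<Longrightarrow> \<one> \<odot>\<^bsub>M\<^esub> x = x"


section \<open>Homomorphisms, isomorphisms and direct summands\<close>

definition module_hom ::
    "('a, 'c) ring_scheme \<Rightarrow> ('a, 'm, 'd) module_scheme \<Rightarrow> ('a, 'n, 'e) module_scheme \<Rightarrow> ('m \<Rightarrow> 'n) set"
  where "module_hom A M N =
    {h \<in> carrier M \<rightarrow>\<^sub>E carrier N.
       (\<forall>x\<in>carrier M. \<forall>y\<in>carrier M. h (x \<oplus>\<^bsub>M\<^esub> y) = h x \<oplus>\<^bsub>N\<^esub> h y) \<and>
       (\<forall>a\<in>carrier A. \<forall>x\<in>carrier M. h (a \<odot>\<^bsub>M\<^esub> x) = a \<odot>\<^bsub>N\<^esub> h x)}"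

definition module_isomorphic ::
    "('a, 'c) ring_scheme \<Rightarrow> ('a, 'm, 'd) module_scheme \<Rightarrow> ('a, 'n, 'e) module_scheme \<Rightarrow> bool"
  where "module_isomorphic A M N \<longleftrightarrow>
    (\<exists>h \<in> module_hom A M N. bij_betw h (carrier M) (carrier N))"

definition direct_summand ::
    "'m set \<Rightarrow> ('a, 'c) ring_scheme \<Rightarrow> ('a, 'm, 'd) module_scheme \<Rightarrow> bool"
  where "direct_summand H A M \<longleftrightarrow> submodule H A M \<and>
    (\<exists>H'. submodule H' A M \<and> H \<inter> H' = {\<zero>\<^bsub>M\<^esub>} \<and> H <+>\<^bsub>M\<^esub> H' = carrier M)"

text \<open>
  For an \<open>R\<close>-algebra \<open>A\<close>, the \<open>R\<close>-module of \<open>A\<close>-linear maps with pointwise operations;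
  \<open>r\<close> acts on an \<open>A\<close>-module as \<open>r \<cdot> 1\<^sub>A\<close>.
\<close>

definition hom_module ::
    "('r, 'a, 'c) module_scheme \<Rightarrow> ('a, 'm, 'd) module_scheme \<Rightarrow> ('a, 'n, 'e) module_scheme
      \<Rightarrow> ('r, 'm \<Rightarrow> 'n) module"
  where "hom_module A M N =
    \<lparr>carrier = module_hom A M N,
     monoid.mult = (\<lambda>_ _. undefined), one = undefined,
     ring.zero = (\<lambda>x\<in>carrier M. \<zero>\<^bsub>N\<^esub>),
     add = (\<lambda>h k. \<lambda>x\<in>carrier M. h x \<oplus>\<^bsub>N\<^esub> k x),
     smult = (\<lambda>r h. \<lambda>x\<in>carrier M. (r \<odot>\<^bsub>A\<^esub> \<one>\<^bsub>A\<^esub>) \<odot>\<^bsub>N\<^esub> h x)\<rparr>"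


section \<open>Group rings\<close>

text \<open>
  The group algebra \<open>RG\<close> of a finite group.  An element \<open>\<Sum>\<^sub>g a\<^sub>g g\<close> is the function \<open>g \<mapsto> a\<^sub>g\<close>
  on \<open>carrier G\<close>.  No finite-support condition is imposed, so this is meant for finite \<open>G\<close> only.
\<close>

definition group_ring ::
    "('r, 'c) ring_scheme \<Rightarrow> ('g, 'd) monoid_scheme \<Rightarrow> ('r, 'g \<Rightarrow> 'r) module"
  where "group_ring R G =
    \<lparr>carrier = carrier G \<rightarrow>\<^sub>E carrier R,
     monoid.mult = (\<lambda>a b. \<lambda>x\<in>carrier G.
       \<Oplus>\<^bsub>R\<^esub>y\<in>carrier G. a y \<otimes>\<^bsub>R\<^esub> b (inv\<^bsub>G\<^esub> y \<otimes>\<^bsub>G\<^esub> x)),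
     one = (\<lambda>x\<in>carrier G. if x = \<one>\<^bsub>G\<^esub> then \<one>\<^bsub>R\<^esub> else \<zero>\<^bsub>R\<^esub>),
     ring.zero = (\<lambda>x\<in>carrier G. \<zero>\<^bsub>R\<^esub>),
     add = (\<lambda>a b. \<lambda>x\<in>carrier G. a x \<oplus>\<^bsub>R\<^esub> b x),
     smult = (\<lambda>r a. \<lambda>x\<in>carrier G. r \<otimes>\<^bsub>R\<^esub> a x)\<rparr>"

text \<open>The ring homomorphism \<open>RG \<rightarrow> RG\<^sub>1\<close> extending \<open>\<phi>\<close> linearly.\<close>

definition group_ring_map ::
    "('r, 'c) ring_scheme \<Rightarrow> ('g, 'd) monoid_scheme \<Rightarrow> ('h, 'e) monoid_scheme \<Rightarrow> ('g \<Rightarrow> 'h)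
      \<Rightarrow> ('g \<Rightarrow> 'r) \<Rightarrow> ('h \<Rightarrow> 'r)"
  where "group_ring_map R G G\<^sub>1 \<phi> a =
    (\<lambda>y\<in>carrier G\<^sub>1. \<Oplus>\<^bsub>R\<^esub>x\<in>{x \<in> carrier G. \<phi> x = y}. a x)"


section \<open>Tensor products\<close>

text \<open>
  For a \<open>B\<close>-\<open>A\<close>-bimodule structure on the ring \<open>B\<close> itself, with left action by multiplication
  and right action \<open>\<rho> b a\<close>, and a left \<open>A\<close>-module \<open>N\<close>, the left \<open>B\<close>-module \<open>B \<otimes>\<^sub>A N\<close> is the
  free abelian group on \<open>B \<times> N\<close> modulo biadditivity and \<open>b a \<otimes> n = b \<otimes> a n\<close>.
\<close>

definition tensor_relations ::
    "('b, 'c) ring_scheme \<Rightarrow> ('b \<Rightarrow> 'a \<Rightarrow> 'b) \<Rightarrow> ('a, 'e) ring_scheme \<Rightarrow> ('a, 'n, 'd) module_scheme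
      \<Rightarrow> ('b \<times> 'n \<Rightarrow>\<^sub>0 int) set"
  where "tensor_relations B \<rho> A N = generate (free_Abelian_group (carrier B \<times> carrier N))
    ({frag_of (b \<oplus>\<^bsub>B\<^esub> b', n) - frag_of (b, n) - frag_of (b', n) | b b' n.
        b \<in> carrier B \<and> b' \<in> carrier B \<and> n \<in> carrier N} \<union>
     {frag_of (b, n \<oplus>\<^bsub>N\<^esub> n') - frag_of (b, n) - frag_of (b, n') | b n n'.
        b \<in> carrier B \<and> n \<in> carrier N \<and> n' \<in> carrier N} \<union>
     {frag_of (\<rho> b a, n) - frag_of (b, a \<odot>\<^bsub>N\<^esub> n) | b a n.
        b \<in> carrier B \<and> a \<in> carrier A \<and> n \<in> carrier N})"

text \<open>
  Elements are cosets.  A scalar \<open>b\<close> acts by \<open>b (b' \<otimes> n) = b b' \<otimes> n\<close>: the image of a coset under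
  this map on formal sums lies in a single coset, and adding the subgroup of relations recovers
  that coset.
\<close>

definition tensor_product ::
    "('b, 'c) ring_scheme \<Rightarrow> ('b \<Rightarrow> 'a \<Rightarrow> 'b) \<Rightarrow> ('a, 'e) ring_scheme \<Rightarrow> ('a, 'n, 'd) module_scheme
      \<Rightarrow> ('b, ('b \<times> 'n \<Rightarrow>\<^sub>0 int) set) module"
  where "tensor_product B \<rho> A N =
    (let F = free_Abelian_group (carrier B \<times> carrier N); T = tensor_relations B \<rho> A N in
     \<lparr>carrier = carrier (F Mod T),
      monoid.mult = (\<lambda>_ _. undefined), one = undefined,
      ring.zero = \<one>\<^bsub>F Mod T\<^esub>,
      add = (\<lambda>C D. C \<otimes>\<^bsub>F Mod T\<^esub> D),
      smult = (\<lambda>b C. T <#>\<^bsub>F\<^esub> (frag_extend (\<lambda>(b', n). frag_of (b \<otimes>\<^bsub>B\<^esub> b', n)) ` C))\<rparr>)"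


section \<open>Induction, restriction and relative projectivity\<close>

definition Ind ::
    "('r, 'c) ring_scheme \<Rightarrow> ('g, 'd) monoid_scheme \<Rightarrow> ('h, 'e) monoid_scheme \<Rightarrow> ('g \<Rightarrow> 'h)
      \<Rightarrow> ('g \<Rightarrow> 'r, 'v, 'f) module_scheme
      \<Rightarrow> ('h \<Rightarrow> 'r, (('h \<Rightarrow> 'r) \<times> 'v \<Rightarrow>\<^sub>0 int) set) module"
  where "Ind R G G\<^sub>1 \<phi> V =
    tensor_product (group_ring R G\<^sub>1)
      (\<lambda>b a. b \<otimes>\<^bsub>group_ring R G\<^sub>1\<^esub> group_ring_map R G G\<^sub>1 \<phi> a) (group_ring R G) V"

definition Res ::
    "('r, 'c) ring_scheme \<Rightarrow> ('g, 'd) monoid_scheme \<Rightarrow> ('h, 'e) monoid_scheme \<Rightarrow> ('g \<Rightarrow> 'h)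
      \<Rightarrow> ('h \<Rightarrow> 'r, 'v, 'f) module_scheme \<Rightarrow> ('g \<Rightarrow> 'r, 'v) module"
  where "Res R G G\<^sub>1 \<phi> V\<^sub>1 =
    \<lparr>carrier = carrier V\<^sub>1, monoid.mult = monoid.mult V\<^sub>1, one = one V\<^sub>1,
     ring.zero = ring.zero V\<^sub>1, add = add V\<^sub>1,
     smult = (\<lambda>a v. group_ring_map R G G\<^sub>1 \<phi> a \<odot>\<^bsub>V\<^sub>1\<^esub> v)\<rparr>"

abbreviation Res_subgroup ::
    "('r, 'c) ring_scheme \<Rightarrow> ('g, 'd) monoid_scheme \<Rightarrow> 'g set
      \<Rightarrow> ('g \<Rightarrow> 'r, 'v, 'f) module_scheme \<Rightarrow> ('g \<Rightarrow> 'r, 'v) module"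
  where "Res_subgroup R G K V \<equiv> Res R (G\<lparr>carrier := K\<rparr>) G (\<lambda>x. x) V"

text \<open>
  HOL cannot quantify over types inside a formula, so the type in which the carrier of the
  \<open>R\<close>-module \<open>V\<^sub>0\<close> lives is a parameter.
\<close>

definition relatively_1_projective ::
    "'w itself \<Rightarrow> ('r, 'c) ring_scheme \<Rightarrow> ('g, 'd) monoid_scheme
      \<Rightarrow> ('g \<Rightarrow> 'r, 'v, 'f) module_scheme \<Rightarrow> bool"
  where "relatively_1_projective TYPE('w) R K V \<longleftrightarrow>
    (\<exists>(V\<^sub>0 :: ('r, 'w) module) H.
       let W = tensor_product (group_ring R K) (\<lambda>b r. r \<odot>\<^bsub>group_ring R K\<^esub> b) R V\<^sub>0 in
       module R V\<^sub>0 \<and> direct_summand H (group_ring R K) W \<and>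
       module_isomorphic (group_ring R K) V (W\<lparr>carrier := H\<rparr>))"

end

theory Submission
  imports Defs
begin

text \<open>
  Write \<open>K = ker \<phi>\<close> and \<open>b \<otimes> v\<close> for the elements of \<open>Ind V = RG\<^sub>1 \<otimes>\<^bsub>RG\<^esub> V\<close>.  The first isomorphism is the
  universal property of the tensor product: \<open>f\<close> goes to \<open>v \<mapsto> f (1 \<otimes> v)\<close>, and \<open>h\<close> comes from
  \<open>b \<otimes> v \<mapsto> b h(v)\<close>.

  For the second one, a function \<open>b\<close> on \<open>G\<^sub>1\<close> pulls back to the function \<open>b \<circ> \<phi>\<close> on \<open>G\<close>, that is, to
  an element of \<open>RG\<close>, and pulling back is \<open>RG\<close>-linear on both sides.  Hence
  \<open>\<tau> (b \<otimes> v) = (b \<circ> \<phi>) v\<close> is a well-defined \<open>RG\<close>-linear map \<open>Ind V \<rightarrow> V\<close>, and the isomorphism is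
  \<open>f \<mapsto> \<tau> \<circ> f\<close>.  On a group element \<open>y\<close> of \<open>G\<^sub>1\<close>, \<open>\<tau> (y \<otimes> v)\<close> vanishes unless \<open>y\<close> lies in \<open>\<phi>(G)\<close>, and
  \<open>\<tau> (1 \<otimes> v)\<close> is the trace \<open>\<Sum>\<^bsub>k \<in> K\<^esub> k v\<close>.  So, up to translation by coset representatives, \<open>\<tau>\<close> is the
  trace from the \<open>K\<close>-coinvariants of \<open>V\<close> to its \<open>K\<close>-invariants, and the point is that relative
  \<open>1\<close>-projectivity makes this trace invertible.

  It does so through an additive \<open>\<theta>\<close> with \<open>\<Sum>\<^bsub>k \<in> K\<^esub> k \<theta> k\<^bsup>-1\<^esup> = id\<close>.  On \<open>RK \<otimes>\<^bsub>R\<^esub> V\<^sub>0\<close> such a map reads off the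
  coefficient at \<open>1\<close>, \<open>b \<otimes> v \<mapsto> b(1) \<otimes> v\<close>, and on a direct summand it is obtained by compressing with
  the inclusion and the projection (\<open>relatively_1_projective_trace_section\<close>).  Given \<open>\<theta>\<close>, the class of
  \<open>\<theta> v\<close> in the coinvariants is the inverse image of an invariant \<open>v\<close> under the trace.

  Let \<open>T\<close> represent the cosets \<open>y \<phi>(G)\<close>.  Every \<open>u\<close> in \<open>Ind V\<close> equals
  \<open>\<Sum>\<^bsub>t \<in> T\<^esub> t \<otimes> \<theta> (\<tau> (t\<^bsup>-1\<^esup> u))\<close> (\<open>reconstruction\<close>), so \<open>u\<close> is determined by the values \<open>\<tau> (c u)\<close> for
  \<open>c\<close> in \<open>RG\<^sub>1\<close>; this gives injectivity.  Conversely, for \<open>h\<close> in \<open>Hom\<^bsub>RG\<^esub>(Res V\<^sub>1, V)\<close> and \<open>w\<close> in \<open>V\<^sub>1\<close> the element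
  \<open>\<Sum>\<^bsub>t \<in> T\<^esub> t \<otimes> \<theta> (h (t\<^bsup>-1\<^esup> w))\<close> has \<open>\<tau> (c u) = h (c w)\<close> for all \<open>c\<close> (\<open>lift_exists\<close>); here \<open>K\<close> acts trivially
  on \<open>Res V\<^sub>1\<close>, so that \<open>h\<close> takes invariant values.  As this property determines \<open>u\<close>, the element
  depends linearly on \<open>w\<close>, whatever the choice of \<open>T\<close> and \<open>\<theta>\<close>; this gives surjectivity.
\<close>

section \<open>Additive maps and finite sums\<close>

lemma (in abelian_monoid) finsum_eq_single:
  assumes "finite A" "i \<in> A" "f i \<in> carrier G" "\<And>j. \<lbrakk>j \<in> A; j \<noteq> i\<rbrakk> \<Longrightarrow> f j = \<zero>"
  shows "finsum G f A = f i"
proof -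
  have "finsum G f A = finsum G f {i}"
  proof (rule add.finprod_mono_neutral_cong_right)
    show "f \<in> A \<rightarrow> carrier G" using assms(3,4) by (metis Pi_I zero_closed)
  qed (use assms in auto)
  then show ?thesis using assms(3) by simp
qed

lemma additive_map_zero:
  assumes "abelian_group M" "abelian_group N" "f \<in> hom (add_monoid M) (add_monoid N)"
  shows "f \<zero>\<^bsub>M\<^esub> = \<zero>\<^bsub>N\<^esub>"
  using hom_one[OF assms(3)] assms(1,2) by (simp add: abelian_group.a_group)

lemma additive_map_finsum:
  assumes "abelian_group M" "abelian_group N" "f \<in> hom (add_monoid M) (add_monoid N)"
    and "finite I" "g \<in> I \<rightarrow> carrier M"
  shows "f (\<Oplus>\<^bsub>M\<^esub>i\<in>I. g i) = (\<Oplus>\<^bsub>N\<^esub>i\<in>I. f (g i))"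
proof -
  interpret M: abelian_group M by fact
  interpret N: abelian_group N by fact
  have f: "f x \<in> carrier N" if "x \<in> carrier M" for x
    using assms(3) that by (auto simp: hom_def)
  show ?thesis
    using assms(4,5)
  proof (induction I)
    case empty
    then show ?case using additive_map_zero[OF assms(1-3)] by simp
  next
    case (insert i I)
    then have "g i \<in> carrier M" "g \<in> I \<rightarrow> carrier M" by auto
    with insert assms(3) f show ?case
      by (auto simp: hom_def Pi_def)
  qed
qed

context left_module begin

lemma smult_left_additive:
  "x \<in> carrier M \<Longrightarrow> (\<lambda>a. a \<odot>\<^bsub>M\<^esub> x) \<in> hom (add_monoid A) (add_monoid M)"
  by (auto simp: hom_def smult_l_distr)

lemma smult_right_additive:
  "a \<in> carrier A \<Longrightarrow> (\<lambda>x. a \<odot>\<^bsub>M\<^esub> x) \<in> hom (add_monoid M) (add_monoid M)"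
  by (auto simp: hom_def smult_r_distr)

lemma smult_zero_left: "x \<in> carrier M \<Longrightarrow> \<zero> \<odot>\<^bsub>M\<^esub> x = \<zero>\<^bsub>M\<^esub>"
  using additive_map_zero[OF A.abelian_group_axioms M.abelian_group_axioms smult_left_additive]
  by simp

lemma smult_finsum_left:
  "\<lbrakk>finite I; g \<in> I \<rightarrow> carrier A; x \<in> carrier M\<rbrakk>
    \<Longrightarrow> (\<Oplus>i\<in>I. g i) \<odot>\<^bsub>M\<^esub> x = (\<Oplus>\<^bsub>M\<^esub>i\<in>I. g i \<odot>\<^bsub>M\<^esub> x)"
  by (rule additive_map_finsum[OF A.abelian_group_axioms M.abelian_group_axioms smult_left_additive])

lemma smult_finsum_right:
  "\<lbrakk>finite I; g \<in> I \<rightarrow> carrier M; a \<in> carrier A\<rbrakk>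
    \<Longrightarrow> a \<odot>\<^bsub>M\<^esub> (\<Oplus>\<^bsub>M\<^esub>i\<in>I. g i) = (\<Oplus>\<^bsub>M\<^esub>i\<in>I. a \<odot>\<^bsub>M\<^esub> g i)"
  by (rule additive_map_finsum[OF M.abelian_group_axioms M.abelian_group_axioms smult_right_additive])

end

section \<open>The group ring of a finite group\<close>

text \<open>
  The element \<open>r g\<close> of the group ring.
\<close>

definition monomial ::
    "('r, 'c) ring_scheme \<Rightarrow> ('g, 'd) monoid_scheme \<Rightarrow> 'r \<Rightarrow> 'g \<Rightarrow> ('g \<Rightarrow> 'r)"
  where "monomial R G r g = (\<lambda>x\<in>carrier G. if x = g then r else \<zero>\<^bsub>R\<^esub>)"

locale finite_group_algebra = R?: cring R + G?: group G
  for R :: "('r, 'c) ring_scheme" (structure) and G :: "('g, 'd) monoid_scheme" +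
  assumes finite_group: "finite (carrier G)"
begin

abbreviation "RG \<equiv> group_ring R G"
abbreviation "mnl \<equiv> monomial R G"

lemma carrier_RG: "carrier RG = carrier G \<rightarrow>\<^sub>E carrier R"
  by (simp add: group_ring_def)

lemma RG_eval: "\<lbrakk>a \<in> carrier RG; x \<in> carrier G\<rbrakk> \<Longrightarrow> a x \<in> carrier R"
  by (auto simp: carrier_RG)

lemma RG_eqI:
  "\<lbrakk>a \<in> carrier RG; b \<in> carrier RG; \<And>x. x \<in> carrier G \<Longrightarrow> a x = b x\<rbrakk> \<Longrightarrow> a = b"
  unfolding carrier_RG by (rule PiE_ext)

lemma RG_add: "x \<in> carrier G \<Longrightarrow> (a \<oplus>\<^bsub>RG\<^esub> b) x = a x \<oplus> b x"
  by (simp add: group_ring_def)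

lemma RG_zero: "x \<in> carrier G \<Longrightarrow> \<zero>\<^bsub>RG\<^esub> x = \<zero>"
  by (simp add: group_ring_def)

lemma RG_smult: "x \<in> carrier G \<Longrightarrow> (r \<odot>\<^bsub>RG\<^esub> a) x = r \<otimes> a x"
  by (simp add: group_ring_def)

lemma RG_mult:
  "x \<in> carrier G \<Longrightarrow> (a \<otimes>\<^bsub>RG\<^esub> b) x = (\<Oplus>y\<in>carrier G. a y \<otimes> b (inv\<^bsub>G\<^esub> y \<otimes>\<^bsub>G\<^esub> x))"
  by (simp add: group_ring_def)

lemma RG_one: "\<one>\<^bsub>RG\<^esub> = mnl \<one> \<one>\<^bsub>G\<^esub>"
  by (simp add: group_ring_def monomial_def)

lemma mnl_eval: "x \<in> carrier G \<Longrightarrow> mnl r g x = (if x = g then r else \<zero>)"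
  by (simp add: monomial_def)

lemma mnl_closed [simp, intro]: "r \<in> carrier R \<Longrightarrow> mnl r g \<in> carrier RG"
  by (simp add: group_ring_def monomial_def)

lemma RG_add_closed: "\<lbrakk>a \<in> carrier RG; b \<in> carrier RG\<rbrakk> \<Longrightarrow> a \<oplus>\<^bsub>RG\<^esub> b \<in> carrier RG"
  by (auto simp: group_ring_def)

lemma RG_zero_closed: "\<zero>\<^bsub>RG\<^esub> \<in> carrier RG"
  by (auto simp: group_ring_def)

lemma RG_smult_closed [simp, intro]:
  "\<lbrakk>r \<in> carrier R; a \<in> carrier RG\<rbrakk> \<Longrightarrow> r \<odot>\<^bsub>RG\<^esub> a \<in> carrier RG"
  by (auto simp: group_ring_def)

lemma RG_mult_closed: "\<lbrakk>a \<in> carrier RG; b \<in> carrier RG\<rbrakk> \<Longrightarrow> a \<otimes>\<^bsub>RG\<^esub> b \<in> carrier RG"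
  by (subst carrier_RG) (auto simp: RG_eval group_ring_def[of R G, THEN arg_cong[where f = monoid.mult]] intro!: R.finsum_closed)

lemma RG_abelian_group: "abelian_group RG"
proof (rule abelian_groupI)
  fix a assume a: "a \<in> carrier RG"
  define b where "b = (\<lambda>x\<in>carrier G. \<ominus> a x)"
  have b: "b \<in> carrier RG" using RG_eval[OF a] by (auto simp: b_def carrier_RG)
  have "b \<oplus>\<^bsub>RG\<^esub> a = \<zero>\<^bsub>RG\<^esub>"
    by (rule RG_eqI)
       (use a b RG_eval[OF a] in \<open>auto simp: RG_add RG_zero RG_add_closed RG_zero_closed b_def R.l_neg\<close>)
  with b show "\<exists>b\<in>carrier RG. b \<oplus>\<^bsub>RG\<^esub> a = \<zero>\<^bsub>RG\<^esub>" by blast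
qed (auto intro!: RG_eqI simp: RG_add RG_zero RG_add_closed RG_zero_closed RG_eval R.a_ac)

lemma RG_finsum_eval:
  assumes "finite I" "f \<in> I \<rightarrow> carrier RG" "x \<in> carrier G"
  shows "(\<Oplus>\<^bsub>RG\<^esub>i\<in>I. f i) x = (\<Oplus>i\<in>I. f i x)"
  by (rule additive_map_finsum[OF RG_abelian_group R.abelian_group_axioms, where f = "\<lambda>a. a x"])
     (use assms in \<open>auto simp: hom_def RG_add RG_eval\<close>)

lemma RG_monomial_sum:
  assumes a: "a \<in> carrier RG"
  shows "a = (\<Oplus>\<^bsub>RG\<^esub>g\<in>carrier G. mnl (a g) g)"
proof -
  interpret RG: abelian_group RG by (rule RG_abelian_group)
  have mnl: "(\<lambda>g. mnl (a g) g) \<in> carrier G \<rightarrow> carrier RG" using RG_eval[OF a] by auto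
  show ?thesis
  proof (rule RG_eqI[OF a])
    show "(\<Oplus>\<^bsub>RG\<^esub>g\<in>carrier G. mnl (a g) g) \<in> carrier RG" using mnl by (rule RG.finsum_closed)
    fix x assume x: "x \<in> carrier G"
    have "(\<Oplus>g\<in>carrier G. mnl (a g) g x) = mnl (a x) x x"
      by (rule R.finsum_eq_single) (use x RG_eval[OF a] finite_group in \<open>auto simp: mnl_eval\<close>)
    then show "a x = (\<Oplus>\<^bsub>RG\<^esub>g\<in>carrier G. mnl (a g) g) x"
      using x mnl finite_group by (simp add: RG_finsum_eval mnl_eval)
  qed
qed

text \<open>
  A property closed under addition may be checked on the elements \<open>r g\<close>; this replaces every
  rearrangement of convolution sums below by a computation in the group.
\<close>

lemma RG_induct [consumes 1, case_names monomial add]: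
  assumes a: "a \<in> carrier RG"
    and mono: "\<And>r g. \<lbrakk>r \<in> carrier R; g \<in> carrier G\<rbrakk> \<Longrightarrow> P (mnl r g)"
    and add: "\<And>a b. \<lbrakk>a \<in> carrier RG; b \<in> carrier RG; P a; P b\<rbrakk> \<Longrightarrow> P (a \<oplus>\<^bsub>RG\<^esub> b)"
  shows "P a"
proof -
  interpret RG: abelian_group RG by (rule RG_abelian_group)
  have "finite I \<Longrightarrow> I \<subseteq> carrier G \<Longrightarrow> P (\<Oplus>\<^bsub>RG\<^esub>g\<in>I. mnl (a g) g)" for I
  proof (induction I rule: finite_induct)
    case empty
    have "\<zero>\<^bsub>RG\<^esub> = mnl \<zero> \<one>\<^bsub>G\<^esub>"
      by (rule RG_eqI) (auto simp: RG_zero mnl_eval)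
    then show ?case using mono[of \<zero> "\<one>\<^bsub>G\<^esub>"] by simp
  next
    case (insert g I)
    then have c: "mnl (a g) g \<in> carrier RG" "(\<lambda>g. mnl (a g) g) \<in> I \<rightarrow> carrier RG"
      using RG_eval[OF a] by auto
    moreover have "P (mnl (a g) g)" "P (\<Oplus>\<^bsub>RG\<^esub>g\<in>I. mnl (a g) g)"
      using insert.IH insert.prems mono[OF RG_eval[OF a]] by auto
    ultimately have "P (mnl (a g) g \<oplus>\<^bsub>RG\<^esub> (\<Oplus>\<^bsub>RG\<^esub>g\<in>I. mnl (a g) g))"
      by (intro add RG.finsum_closed)
    with RG.finsum_insert[OF insert.hyps(1,2) c(2,1)] show ?case by (simp only:)
  qed
  from this[OF finite_group subset_refl] show ?thesis
    by (simp only: RG_monomial_sum[OF a, symmetric])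
qed

lemma RG_l_distr:
  assumes "a \<in> carrier RG" "b \<in> carrier RG" "c \<in> carrier RG"
  shows "(a \<oplus>\<^bsub>RG\<^esub> b) \<otimes>\<^bsub>RG\<^esub> c = a \<otimes>\<^bsub>RG\<^esub> c \<oplus>\<^bsub>RG\<^esub> b \<otimes>\<^bsub>RG\<^esub> c"
proof (rule RG_eqI)
  fix x assume x: "x \<in> carrier G"
  have "(\<Oplus>y\<in>carrier G. (a \<oplus>\<^bsub>RG\<^esub> b) y \<otimes> c (inv\<^bsub>G\<^esub> y \<otimes>\<^bsub>G\<^esub> x))
      = (\<Oplus>y\<in>carrier G. a y \<otimes> c (inv\<^bsub>G\<^esub> y \<otimes>\<^bsub>G\<^esub> x) \<oplus> b y \<otimes> c (inv\<^bsub>G\<^esub> y \<otimes>\<^bsub>G\<^esub> x))"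
    by (rule R.finsum_cong') (use assms x in \<open>auto simp: RG_add RG_eval R.l_distr\<close>)
  also have "\<dots> = (\<Oplus>y\<in>carrier G. a y \<otimes> c (inv\<^bsub>G\<^esub> y \<otimes>\<^bsub>G\<^esub> x))
      \<oplus> (\<Oplus>y\<in>carrier G. b y \<otimes> c (inv\<^bsub>G\<^esub> y \<otimes>\<^bsub>G\<^esub> x))"
    by (rule R.finsum_addf) (use assms x in \<open>auto simp: RG_eval\<close>)
  finally show "((a \<oplus>\<^bsub>RG\<^esub> b) \<otimes>\<^bsub>RG\<^esub> c) x = (a \<otimes>\<^bsub>RG\<^esub> c \<oplus>\<^bsub>RG\<^esub> b \<otimes>\<^bsub>RG\<^esub> c) x"
    using x by (simp add: RG_mult RG_add)
qed (use assms in \<open>auto simp: RG_add_closed RG_mult_closed\<close>)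

lemma RG_r_distr:
  assumes "a \<in> carrier RG" "b \<in> carrier RG" "c \<in> carrier RG"
  shows "c \<otimes>\<^bsub>RG\<^esub> (a \<oplus>\<^bsub>RG\<^esub> b) = c \<otimes>\<^bsub>RG\<^esub> a \<oplus>\<^bsub>RG\<^esub> c \<otimes>\<^bsub>RG\<^esub> b"
proof (rule RG_eqI)
  fix x assume x: "x \<in> carrier G"
  have "(\<Oplus>y\<in>carrier G. c y \<otimes> (a \<oplus>\<^bsub>RG\<^esub> b) (inv\<^bsub>G\<^esub> y \<otimes>\<^bsub>G\<^esub> x))
      = (\<Oplus>y\<in>carrier G. c y \<otimes> a (inv\<^bsub>G\<^esub> y \<otimes>\<^bsub>G\<^esub> x) \<oplus> c y \<otimes> b (inv\<^bsub>G\<^esub> y \<otimes>\<^bsub>G\<^esub> x))"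
    by (rule R.finsum_cong') (use assms x in \<open>auto simp: RG_add RG_eval R.r_distr\<close>)
  also have "\<dots> = (\<Oplus>y\<in>carrier G. c y \<otimes> a (inv\<^bsub>G\<^esub> y \<otimes>\<^bsub>G\<^esub> x))
      \<oplus> (\<Oplus>y\<in>carrier G. c y \<otimes> b (inv\<^bsub>G\<^esub> y \<otimes>\<^bsub>G\<^esub> x))"
    by (rule R.finsum_addf) (use assms x in \<open>auto simp: RG_eval\<close>)
  finally show "(c \<otimes>\<^bsub>RG\<^esub> (a \<oplus>\<^bsub>RG\<^esub> b)) x = (c \<otimes>\<^bsub>RG\<^esub> a \<oplus>\<^bsub>RG\<^esub> c \<otimes>\<^bsub>RG\<^esub> b) x"
    using x by (simp add: RG_mult RG_add)
qed (use assms in \<open>auto simp: RG_add_closed RG_mult_closed\<close>)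

lemma mnl_mult_eval:
  assumes "r \<in> carrier R" "g \<in> carrier G" "a \<in> carrier RG" "x \<in> carrier G"
  shows "(mnl r g \<otimes>\<^bsub>RG\<^esub> a) x = r \<otimes> a (inv\<^bsub>G\<^esub> g \<otimes>\<^bsub>G\<^esub> x)"
proof -
  have "(\<Oplus>y\<in>carrier G. mnl r g y \<otimes> a (inv\<^bsub>G\<^esub> y \<otimes>\<^bsub>G\<^esub> x)) = mnl r g g \<otimes> a (inv\<^bsub>G\<^esub> g \<otimes>\<^bsub>G\<^esub> x)"
    by (rule R.finsum_eq_single) (use assms finite_group in \<open>auto simp: mnl_eval RG_eval\<close>)
  then show ?thesis using assms by (simp add: RG_mult mnl_eval)
qed

lemma mult_mnl_eval:
  assumes "r \<in> carrier R" "g \<in> carrier G" "a \<in> carrier RG" "x \<in> carrier G"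
  shows "(a \<otimes>\<^bsub>RG\<^esub> mnl r g) x = a (x \<otimes>\<^bsub>G\<^esub> inv\<^bsub>G\<^esub> g) \<otimes> r"
proof -
  have *: "inv\<^bsub>G\<^esub> y \<otimes>\<^bsub>G\<^esub> x = g \<longleftrightarrow> y = x \<otimes>\<^bsub>G\<^esub> inv\<^bsub>G\<^esub> g" if "y \<in> carrier G" for y
    using G.inv_solve_left'[of g y x] G.inv_solve_right[of y x g] that assms by simp
  have "(\<Oplus>y\<in>carrier G. a y \<otimes> mnl r g (inv\<^bsub>G\<^esub> y \<otimes>\<^bsub>G\<^esub> x))
      = a (x \<otimes>\<^bsub>G\<^esub> inv\<^bsub>G\<^esub> g) \<otimes> mnl r g (inv\<^bsub>G\<^esub> (x \<otimes>\<^bsub>G\<^esub> inv\<^bsub>G\<^esub> g) \<otimes>\<^bsub>G\<^esub> x)"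
    by (rule R.finsum_eq_single) (use assms finite_group in \<open>auto simp: mnl_eval RG_eval *\<close>)
  then show ?thesis using assms by (simp add: RG_mult mnl_eval *)
qed

lemma mnl_mult_mnl:
  assumes "r \<in> carrier R" "g \<in> carrier G" "s \<in> carrier R" "h \<in> carrier G"
  shows "mnl r g \<otimes>\<^bsub>RG\<^esub> mnl s h = mnl (r \<otimes> s) (g \<otimes>\<^bsub>G\<^esub> h)"
proof (rule RG_eqI)
  fix x assume x: "x \<in> carrier G"
  have "inv\<^bsub>G\<^esub> g \<otimes>\<^bsub>G\<^esub> x = h \<longleftrightarrow> x = g \<otimes>\<^bsub>G\<^esub> h"
    using x assms by (intro G.inv_solve_left')
  then show "(mnl r g \<otimes>\<^bsub>RG\<^esub> mnl s h) x = mnl (r \<otimes> s) (g \<otimes>\<^bsub>G\<^esub> h) x"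
    using x assms by (simp add: mnl_mult_eval mnl_eval)
qed (use assms in \<open>auto simp: RG_mult_closed\<close>)

text \<open>
  Both sides are additive in each of the three factors, so associativity reduces to the group law.
\<close>

lemma RG_m_assoc:
  assumes "a \<in> carrier RG" "b \<in> carrier RG" "c \<in> carrier RG"
  shows "(a \<otimes>\<^bsub>RG\<^esub> b) \<otimes>\<^bsub>RG\<^esub> c = a \<otimes>\<^bsub>RG\<^esub> (b \<otimes>\<^bsub>RG\<^esub> c)"
  using assms(3)
proof (induction c rule: RG_induct)
  case c: (monomial t k)
  from assms(2) show ?case
  proof (induction b rule: RG_induct)
    case b: (monomial s h)
    from assms(1) show ?case
    proof (induction a rule: RG_induct)
      case (monomial r g)
      with b c show ?case by (simp add: mnl_mult_mnl R.m_assoc G.m_assoc)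
    qed (use b c in \<open>simp add: RG_l_distr RG_mult_closed\<close>)
  qed (use assms(1) c in \<open>simp add: RG_l_distr RG_r_distr RG_mult_closed\<close>)
qed (use assms(1,2) in \<open>simp add: RG_r_distr RG_mult_closed\<close>)

lemma RG_ring: "ring RG"
proof (rule ringI)
  show "abelian_group RG" by (rule RG_abelian_group)
  show "Group.monoid RG"
  proof (rule monoidI)
    fix a assume a: "a \<in> carrier RG"
    show "\<one>\<^bsub>RG\<^esub> \<otimes>\<^bsub>RG\<^esub> a = a"
      by (rule RG_eqI) (use a in \<open>auto simp: RG_one mnl_mult_eval RG_mult_closed RG_eval\<close>)
    show "a \<otimes>\<^bsub>RG\<^esub> \<one>\<^bsub>RG\<^esub> = a"
      by (rule RG_eqI) (use a in \<open>auto simp: RG_one mult_mnl_eval RG_mult_closed RG_eval\<close>)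
  qed (auto simp: RG_mult_closed RG_m_assoc RG_one)
qed (auto simp: RG_l_distr RG_r_distr)

text \<open>
  The structure of an \<open>R\<close>-module on a module of homomorphisms is defined through \<open>r \<cdot> 1\<close>; it is the
  monomial at the neutral element, and it is central because \<open>R\<close> is commutative.
\<close>

lemma scalar_one: "r \<in> carrier R \<Longrightarrow> r \<odot>\<^bsub>RG\<^esub> \<one>\<^bsub>RG\<^esub> = mnl r \<one>\<^bsub>G\<^esub>"
  by (rule RG_eqI) (auto simp: RG_one RG_smult mnl_eval)

lemma scalar_central:
  assumes "r \<in> carrier R" "a \<in> carrier RG"
  shows "mnl r \<one>\<^bsub>G\<^esub> \<otimes>\<^bsub>RG\<^esub> a = a \<otimes>\<^bsub>RG\<^esub> mnl r \<one>\<^bsub>G\<^esub>"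
  by (rule RG_eqI)
     (use assms in \<open>auto simp: RG_mult_closed mnl_mult_eval mult_mnl_eval RG_eval R.m_comm\<close>)

end

locale group_algebra_hom =
  G: finite_group_algebra R G + G1: finite_group_algebra R G\<^sub>1
  for R :: "('r, 'c) ring_scheme" (structure) and G :: "('g, 'd) monoid_scheme"
    and G\<^sub>1 :: "('h, 'e) monoid_scheme" +
  fixes \<phi> :: "'g \<Rightarrow> 'h"
  assumes hom: "\<phi> \<in> hom G G\<^sub>1"
begin

abbreviation "map_RG \<equiv> group_ring_map R G G\<^sub>1 \<phi>"

lemma phi_closed [simp, intro]: "x \<in> carrier G \<Longrightarrow> \<phi> x \<in> carrier G\<^sub>1"
  using hom by (rule hom_in_carrier)

lemma phi_mult: "\<lbrakk>x \<in> carrier G; y \<in> carrier G\<rbrakk> \<Longrightarrow> \<phi> (x \<otimes>\<^bsub>G\<^esub> y) = \<phi> x \<otimes>\<^bsub>G\<^sub>1\<^esub> \<phi> y"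
  using hom by (rule hom_mult)

lemma phi_one: "\<phi> \<one>\<^bsub>G\<^esub> = \<one>\<^bsub>G\<^sub>1\<^esub>"
  using hom_one[OF hom] G.is_group G1.is_group by simp

lemma phi_inv: "x \<in> carrier G \<Longrightarrow> \<phi> (inv\<^bsub>G\<^esub> x) = inv\<^bsub>G\<^sub>1\<^esub> \<phi> x"
  using group_hom.hom_inv[of G G\<^sub>1 \<phi>] G.is_group G1.is_group hom
  by (simp add: group_hom_def group_hom_axioms_def)

lemma finite_fibre: "finite {x \<in> carrier G. \<phi> x = y}"
  using G.finite_group by simp

lemma map_RG_closed [simp, intro]: "a \<in> carrier G.RG \<Longrightarrow> map_RG a \<in> carrier G1.RG"
  by (auto simp: group_ring_map_def G1.carrier_RG G.RG_eval intro!: G.finsum_closed)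

lemma map_RG_add:
  assumes "a \<in> carrier G.RG" "b \<in> carrier G.RG"
  shows "map_RG (a \<oplus>\<^bsub>G.RG\<^esub> b) = map_RG a \<oplus>\<^bsub>G1.RG\<^esub> map_RG b"
proof (rule G1.RG_eqI)
  fix y assume y: "y \<in> carrier G\<^sub>1"
  have "(\<Oplus>x\<in>{x \<in> carrier G. \<phi> x = y}. (a \<oplus>\<^bsub>G.RG\<^esub> b) x)
      = (\<Oplus>x\<in>{x \<in> carrier G. \<phi> x = y}. a x \<oplus> b x)"
    by (rule G.finsum_cong') (use assms in \<open>auto simp: G.RG_add G.RG_eval\<close>)
  also have "\<dots> = (\<Oplus>x\<in>{x \<in> carrier G. \<phi> x = y}. a x) \<oplus> (\<Oplus>x\<in>{x \<in> carrier G. \<phi> x = y}. b x)"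
    by (rule G.finsum_addf) (use assms in \<open>auto simp: G.RG_eval\<close>)
  finally show "map_RG (a \<oplus>\<^bsub>G.RG\<^esub> b) y = (map_RG a \<oplus>\<^bsub>G1.RG\<^esub> map_RG b) y"
    using y by (simp add: group_ring_map_def G1.RG_add)
qed (use assms in \<open>auto simp: G.RG_add_closed G1.RG_add_closed\<close>)

lemma map_RG_mnl:
  assumes "r \<in> carrier R" "g \<in> carrier G"
  shows "map_RG (G.mnl r g) = G1.mnl r (\<phi> g)"
proof (rule G1.RG_eqI)
  fix y assume y: "y \<in> carrier G\<^sub>1"
  show "map_RG (G.mnl r g) y = G1.mnl r (\<phi> g) y"
  proof (cases "y = \<phi> g")
    case True
    have "(\<Oplus>x\<in>{x \<in> carrier G. \<phi> x = y}. G.mnl r g x) = G.mnl r g g"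
      by (rule G.finsum_eq_single) (use assms True finite_fibre in \<open>auto simp: G.mnl_eval\<close>)
    then show ?thesis using True y assms by (simp add: group_ring_map_def G1.mnl_eval G.mnl_eval)
  next
    case False
    have "(\<Oplus>x\<in>{x \<in> carrier G. \<phi> x = y}. G.mnl r g x) = \<zero>"
      by (rule G.add.finprod_one_eqI) (use False in \<open>auto simp: G.mnl_eval\<close>)
    then show ?thesis using False y by (simp add: group_ring_map_def G1.mnl_eval)
  qed
qed (use assms in auto)

end

section \<open>Tensor products\<close>

definition pure_tensor ::
    "('b, 'c) ring_scheme \<Rightarrow> ('b \<Rightarrow> 'a \<Rightarrow> 'b) \<Rightarrow> ('a, 'e) ring_scheme \<Rightarrow> ('a, 'n, 'd) module_scheme
      \<Rightarrow> 'b \<Rightarrow> 'n \<Rightarrow> ('b \<times> 'n \<Rightarrow>\<^sub>0 int) set"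
  where "pure_tensor B \<rho> A N b n =
    tensor_relations B \<rho> A N #>\<^bsub>free_Abelian_group (carrier B \<times> carrier N)\<^esub> frag_of (b, n)"

text \<open>
  The conditions under which \<open>B \<otimes>\<^bsub>A\<^esub> N\<close> is a left \<open>B\<close>-module; the associativity makes the left action
  compatible with the balancing relation.  Both an \<open>RG\<close>-module \<open>V\<close> with \<open>B = RG\<^sub>1\<close> and an
  \<open>R\<close>-module \<open>V\<^sub>0\<close> with \<open>B = RK\<close> are instances.
\<close>

locale tensor = B: ring B + N: abelian_group N
  for B :: "('b, 'c) ring_scheme" and \<rho> :: "'b \<Rightarrow> 'a \<Rightarrow> 'b"
    and A :: "('a, 'e) ring_scheme" and N :: "('a, 'n, 'd) module_scheme" +
  assumes rho_closed: "\<lbrakk>b \<in> carrier B; a \<in> carrier A\<rbrakk> \<Longrightarrow> \<rho> b a \<in> carrier B"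
    and rho_assoc: "\<lbrakk>c \<in> carrier B; b \<in> carrier B; a \<in> carrier A\<rbrakk>
        \<Longrightarrow> c \<otimes>\<^bsub>B\<^esub> \<rho> b a = \<rho> (c \<otimes>\<^bsub>B\<^esub> b) a"
    and act_closed: "\<lbrakk>a \<in> carrier A; n \<in> carrier N\<rbrakk> \<Longrightarrow> a \<odot>\<^bsub>N\<^esub> n \<in> carrier N"
begin

abbreviation "TP \<equiv> tensor_product B \<rho> A N"
abbreviation "tens \<equiv> pure_tensor B \<rho> A N"
abbreviation "Free \<equiv> free_Abelian_group (carrier B \<times> carrier N)"
abbreviation "Rel \<equiv> tensor_relations B \<rho> A N"

definition relators :: "('b \<times> 'n \<Rightarrow>\<^sub>0 int) set" where
  "relators =
    {frag_of (b \<oplus>\<^bsub>B\<^esub> b', n) - frag_of (b, n) - frag_of (b', n) | b b' n.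
        b \<in> carrier B \<and> b' \<in> carrier B \<and> n \<in> carrier N} \<union>
    {frag_of (b, n \<oplus>\<^bsub>N\<^esub> n') - frag_of (b, n) - frag_of (b, n') | b n n'.
        b \<in> carrier B \<and> n \<in> carrier N \<and> n' \<in> carrier N} \<union>
    {frag_of (\<rho> b a, n) - frag_of (b, a \<odot>\<^bsub>N\<^esub> n) | b a n.
        b \<in> carrier B \<and> a \<in> carrier A \<and> n \<in> carrier N}"

lemma relatorsE:
  assumes "x \<in> relators"
  obtains
    (left) b b' n where "b \<in> carrier B" "b' \<in> carrier B" "n \<in> carrier N"
      "x = frag_of (b \<oplus>\<^bsub>B\<^esub> b', n) - frag_of (b, n) - frag_of (b', n)"
  | (right) b n n' where "b \<in> carrier B" "n \<in> carrier N" "n' \<in> carrier N"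
      "x = frag_of (b, n \<oplus>\<^bsub>N\<^esub> n') - frag_of (b, n) - frag_of (b, n')"
  | (balanced) b a n where "b \<in> carrier B" "a \<in> carrier A" "n \<in> carrier N"
      "x = frag_of (\<rho> b a, n) - frag_of (b, a \<odot>\<^bsub>N\<^esub> n)"
  using assms unfolding relators_def
proof (elim UnE CollectE exE conjE)
  show thesis if "x = frag_of (b \<oplus>\<^bsub>B\<^esub> b', n) - frag_of (b, n) - frag_of (b', n)"
    "b \<in> carrier B" "b' \<in> carrier B" "n \<in> carrier N" for b b' n
    by (rule left[OF that(2-4,1)])
  show thesis if "x = frag_of (b, n \<oplus>\<^bsub>N\<^esub> n') - frag_of (b, n) - frag_of (b, n')"
    "b \<in> carrier B" "n \<in> carrier N" "n' \<in> carrier N" for b n n'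
    by (rule right[OF that(2-4,1)])
  show thesis if "x = frag_of (\<rho> b a, n) - frag_of (b, a \<odot>\<^bsub>N\<^esub> n)"
    "b \<in> carrier B" "a \<in> carrier A" "n \<in> carrier N" for b a n
    by (rule balanced[OF that(2-4,1)])
qed

lemma Rel_eq: "Rel = generate Free relators"
  by (simp add: tensor_relations_def relators_def)

lemma diff_in_Free:
  "\<lbrakk>u \<in> carrier Free; v \<in> carrier Free\<rbrakk> \<Longrightarrow> u - v \<in> carrier Free"
  using keys_diff[of u v] by auto

lemma add_in_Free:
  "\<lbrakk>u \<in> carrier Free; v \<in> carrier Free\<rbrakk> \<Longrightarrow> u + v \<in> carrier Free"
  using keys_add[of u v] by auto

lemma relators_subset: "relators \<subseteq> carrier Free"
  unfolding relators_def
  by (auto simp del: carrier_free_Abelian_group_iff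
        intro!: diff_in_Free simp: rho_closed act_closed)

sublocale F: comm_group Free
  by (rule abelian_free_Abelian_group)

lemma Rel_subgroup: "subgroup Rel Free"
  unfolding Rel_eq by (rule F.generate_is_subgroup[OF relators_subset])

lemma Rel_normal: "Rel \<lhd> Free"
  by (rule F.subgroup_imp_normal[OF Rel_subgroup])

lemma relator_in_Rel: "u \<in> relators \<Longrightarrow> u \<in> Rel"
  unfolding Rel_eq by (rule generate.incl)

lemma TP_simps:
  "carrier TP = carrier (Free Mod Rel)" "add TP = monoid.mult (Free Mod Rel)"
  "\<zero>\<^bsub>TP\<^esub> = \<one>\<^bsub>Free Mod Rel\<^esub>"
  by (simp_all add: tensor_product_def Let_def)

lemma carrier_TP: "carrier TP = (\<lambda>u. Rel #>\<^bsub>Free\<^esub> u) ` carrier Free"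
  by (simp add: tensor_product_def Let_def carrier_FactGroup)

lemma TP_abelian_group: "abelian_group TP"
proof -
  interpret Q: comm_group "Free Mod Rel" by (rule F.abelian_FactGroup[OF Rel_subgroup])
  show ?thesis
    by (rule abelian_groupI; unfold TP_simps)
       (use Q.l_inv_ex in \<open>simp_all add: Q.m_ac del: mult_FactGroup one_FactGroup\<close>)
qed

sublocale TP: abelian_group TP
  by (rule TP_abelian_group)

lemma coset_hom: "(\<lambda>u. Rel #>\<^bsub>Free\<^esub> u) \<in> hom Free (add_monoid TP)"
  using normal.r_coset_hom_Mod[OF Rel_normal] by (simp add: hom_def TP_simps)

lemma coset_add:
  "\<lbrakk>u \<in> carrier Free; v \<in> carrier Free\<rbrakk>
    \<Longrightarrow> Rel #>\<^bsub>Free\<^esub> (u + v) = (Rel #>\<^bsub>Free\<^esub> u) \<oplus>\<^bsub>TP\<^esub> (Rel #>\<^bsub>Free\<^esub> v)"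
  using hom_mult[OF coset_hom, of u v] by (simp del: carrier_free_Abelian_group_iff)

lemma coset_eqI:
  assumes "u \<in> carrier Free" "v \<in> carrier Free" "u - v \<in> Rel"
  shows "Rel #>\<^bsub>Free\<^esub> u = Rel #>\<^bsub>Free\<^esub> v"
proof -
  have "u \<in> Rel #>\<^bsub>Free\<^esub> v"
    using assms by (intro subgroup.rcos_module_rev[OF Rel_subgroup F.is_group]) auto
  then show ?thesis using F.repr_independence[OF _ assms(2) Rel_subgroup] by simp
qed

lemma frag_of_in_Free: "\<lbrakk>b \<in> carrier B; n \<in> carrier N\<rbrakk> \<Longrightarrow> frag_of (b, n) \<in> carrier Free"
  by simp

lemma tens_closed [simp, intro]: "\<lbrakk>b \<in> carrier B; n \<in> carrier N\<rbrakk> \<Longrightarrow> tens b n \<in> carrier TP"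
  by (auto simp: pure_tensor_def carrier_TP)

lemma tens_add_left:
  assumes "b \<in> carrier B" "b' \<in> carrier B" "n \<in> carrier N"
  shows "tens (b \<oplus>\<^bsub>B\<^esub> b') n = tens b n \<oplus>\<^bsub>TP\<^esub> tens b' n"
proof -
  let ?u = "frag_of (b \<oplus>\<^bsub>B\<^esub> b', n)" and ?v = "frag_of (b, n)" and ?w = "frag_of (b', n)"
  have free: "?u \<in> carrier Free" "?v \<in> carrier Free" "?w \<in> carrier Free"
    using assms by simp_all
  have "?u - ?v - ?w \<in> relators" unfolding relators_def using assms by blast
  then have "?u - (?v + ?w) \<in> Rel" using relator_in_Rel by (simp add: diff_diff_add)
  then have "Rel #>\<^bsub>Free\<^esub> ?u = Rel #>\<^bsub>Free\<^esub> (?v + ?w)"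
    by (intro coset_eqI add_in_Free free)
  then show ?thesis by (simp only: pure_tensor_def coset_add[OF free(2,3)])
qed

lemma tens_add_right:
  assumes "b \<in> carrier B" "n \<in> carrier N" "n' \<in> carrier N"
  shows "tens b (n \<oplus>\<^bsub>N\<^esub> n') = tens b n \<oplus>\<^bsub>TP\<^esub> tens b n'"
proof -
  let ?u = "frag_of (b, n \<oplus>\<^bsub>N\<^esub> n')" and ?v = "frag_of (b, n)" and ?w = "frag_of (b, n')"
  have free: "?u \<in> carrier Free" "?v \<in> carrier Free" "?w \<in> carrier Free"
    using assms by simp_all
  have "?u - ?v - ?w \<in> relators" unfolding relators_def using assms by blast
  then have "?u - (?v + ?w) \<in> Rel" using relator_in_Rel by (simp add: diff_diff_add)
  then have "Rel #>\<^bsub>Free\<^esub> ?u = Rel #>\<^bsub>Free\<^esub> (?v + ?w)"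
    by (intro coset_eqI add_in_Free free)
  then show ?thesis by (simp only: pure_tensor_def coset_add[OF free(2,3)])
qed

lemma tens_balanced:
  assumes "b \<in> carrier B" "a \<in> carrier A" "n \<in> carrier N"
  shows "tens (\<rho> b a) n = tens b (a \<odot>\<^bsub>N\<^esub> n)"
  unfolding pure_tensor_def
proof (rule coset_eqI)
  have "frag_of (\<rho> b a, n) - frag_of (b, a \<odot>\<^bsub>N\<^esub> n) \<in> relators"
    unfolding relators_def using assms by blast
  then show "frag_of (\<rho> b a, n) - frag_of (b, a \<odot>\<^bsub>N\<^esub> n) \<in> Rel" by (rule relator_in_Rel)
qed (use assms in \<open>simp_all add: rho_closed act_closed\<close>)

lemma tens_left_additive:
  "n \<in> carrier N \<Longrightarrow> (\<lambda>b. tens b n) \<in> hom (add_monoid B) (add_monoid TP)"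
  by (auto simp: hom_def tens_add_left)

lemma tens_right_additive:
  "b \<in> carrier B \<Longrightarrow> (\<lambda>n. tens b n) \<in> hom (add_monoid N) (add_monoid TP)"
  by (auto simp: hom_def tens_add_right)

lemma tens_finsum_right:
  assumes "b \<in> carrier B" "finite I" "g \<in> I \<rightarrow> carrier N"
  shows "tens b (\<Oplus>\<^bsub>N\<^esub>i\<in>I. g i) = (\<Oplus>\<^bsub>TP\<^esub>i\<in>I. tens b (g i))"
  by (rule additive_map_finsum[OF N.abelian_group_axioms TP_abelian_group tens_right_additive])
     (use assms in auto)

text \<open>
  Pure tensors generate the tensor product under addition alone, because
  \<open>- (b \<otimes> n) = (- b) \<otimes> n\<close> and \<open>0 = 0 \<otimes> 0\<close>.
\<close>

lemma TP_induct [consumes 1, case_names tens add]: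
  assumes u: "u \<in> carrier TP"
    and tens: "\<And>b n. \<lbrakk>b \<in> carrier B; n \<in> carrier N\<rbrakk> \<Longrightarrow> P (tens b n)"
    and add: "\<And>u v. \<lbrakk>u \<in> carrier TP; v \<in> carrier TP; P u; P v\<rbrakk> \<Longrightarrow> P (u \<oplus>\<^bsub>TP\<^esub> v)"
  shows "P u"
proof -
  let ?c = "\<lambda>u. Rel #>\<^bsub>Free\<^esub> u"
  have closed: "?c x \<in> carrier TP" if "x \<in> carrier Free" for x
    using that by (auto simp: carrier_TP)
  have zero: "?c 0 = tens \<zero>\<^bsub>B\<^esub> \<zero>\<^bsub>N\<^esub>"
    using additive_map_zero[OF B.abelian_group_axioms TP_abelian_group tens_left_additive, of "\<zero>\<^bsub>N\<^esub>"]
      hom_one[OF coset_hom F.is_group TP.add.is_group] by simp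
  have neg: "?c (- frag_of (b, n)) = tens (\<ominus>\<^bsub>B\<^esub> b) n" if "b \<in> carrier B" "n \<in> carrier N" for b n
  proof -
    have "?c (- frag_of (b, n)) \<oplus>\<^bsub>TP\<^esub> tens b n = ?c (- frag_of (b, n) + frag_of (b, n))"
      unfolding pure_tensor_def by (rule coset_add[symmetric]) (use that in auto)
    also have "\<dots> = \<zero>\<^bsub>TP\<^esub>"
      using hom_one[OF coset_hom F.is_group TP.add.is_group] by simp
    also have "\<dots> = tens (\<ominus>\<^bsub>B\<^esub> b) n \<oplus>\<^bsub>TP\<^esub> tens b n"
      using additive_map_zero[OF B.abelian_group_axioms TP_abelian_group tens_left_additive, of n]
        tens_add_left[of "\<ominus>\<^bsub>B\<^esub> b" b n] that by (simp add: B.l_neg)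
    finally show ?thesis
      using that closed[of "- frag_of (b, n)"] by (simp add: TP.add.right_cancel)
  qed
  have "P (?c x) \<and> P (?c (- x))" if "Poly_Mapping.keys x \<subseteq> carrier B \<times> carrier N" for x
    using that
  proof (induction rule: free_Abelian_group_induct[consumes 1, case_names nil diff of])
    case nil
    then show ?case by (simp add: zero tens)
  next
    case (diff x y)
    then have "P (?c x \<oplus>\<^bsub>TP\<^esub> ?c (- y))" "P (?c (- x) \<oplus>\<^bsub>TP\<^esub> ?c y)"
      by (auto intro!: add closed)
    with diff show ?case using coset_add[of x "- y"] coset_add[of "- x" y]
      by (simp del: mult_free_Abelian_group)
  next
    case (of z)
    then obtain b n where z: "z = (b, n)" "b \<in> carrier B" "n \<in> carrier N" by auto
    then show ?case using tens[of b n] tens[of "\<ominus>\<^bsub>B\<^esub> b" n] neg[of b n]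
      by (simp add: pure_tensor_def)
  qed
  with u show ?thesis by (auto simp: carrier_TP)
qed

text \<open>
  The free abelian group extends \<open>g\<close> to a homomorphism, and the three conditions on \<open>g\<close> say that its
  kernel contains the three kinds of relators.
\<close>

lemma TP_universal:
  assumes Q: "abelian_group Q"
    and g: "\<And>b n. \<lbrakk>b \<in> carrier B; n \<in> carrier N\<rbrakk> \<Longrightarrow> g b n \<in> carrier Q"
    and left: "\<And>b b' n. \<lbrakk>b \<in> carrier B; b' \<in> carrier B; n \<in> carrier N\<rbrakk>
        \<Longrightarrow> g (b \<oplus>\<^bsub>B\<^esub> b') n = g b n \<oplus>\<^bsub>Q\<^esub> g b' n"
    and right: "\<And>b n n'. \<lbrakk>b \<in> carrier B; n \<in> carrier N; n' \<in> carrier N\<rbrakk>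
        \<Longrightarrow> g b (n \<oplus>\<^bsub>N\<^esub> n') = g b n \<oplus>\<^bsub>Q\<^esub> g b n'"
    and balanced: "\<And>b a n. \<lbrakk>b \<in> carrier B; a \<in> carrier A; n \<in> carrier N\<rbrakk>
        \<Longrightarrow> g (\<rho> b a) n = g b (a \<odot>\<^bsub>N\<^esub> n)"
  obtains f where "f \<in> hom (add_monoid TP) (add_monoid Q)"
    "\<And>b n. \<lbrakk>b \<in> carrier B; n \<in> carrier N\<rbrakk> \<Longrightarrow> f (tens b n) = g b n"
proof -
  interpret Q: abelian_group Q by fact
  have img: "(\<lambda>(b, n). g b n) ` (carrier B \<times> carrier N) \<subseteq> carrier (add_monoid Q)"
    using g by auto
  obtain h where h: "h \<in> hom Free (add_monoid Q)"
    and h_frag: "\<And>z. z \<in> carrier B \<times> carrier N \<Longrightarrow> h (frag_of z) = (case z of (b, n) \<Rightarrow> g b n)"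
    by (rule comm_group.free_Abelian_group_universal[OF Q.a_comm_group img]) (rule that)
  have h_of: "h (frag_of (b, n)) = g b n" if "b \<in> carrier B" "n \<in> carrier N" for b n
    using h_frag[of "(b, n)"] that by simp
  interpret h: group_hom Free "add_monoid Q" h
    using h by (simp add: group_hom_def group_hom_axioms_def F.is_group Q.a_group)
  have h_add: "h (u + v) = h u \<oplus>\<^bsub>Q\<^esub> h v" if "u \<in> carrier Free" "v \<in> carrier Free" for u v
    using hom_mult[OF h that] by simp
  have kernelI: "u - v \<in> kernel Free (add_monoid Q) h"
    if "u \<in> carrier Free" "v \<in> carrier Free" "h u = h v" for u v
  proof -
    have closed: "u - v \<in> carrier Free" using that by (intro diff_in_Free)
    have "h u = h (u - v) \<oplus>\<^bsub>Q\<^esub> h v"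
      using h_add[OF closed that(2)] by simp
    moreover have "h v \<in> carrier Q" "h (u - v) \<in> carrier Q"
      using h.hom_closed[OF that(2)] h.hom_closed[OF closed] by simp_all
    ultimately have "h (u - v) = \<zero>\<^bsub>Q\<^esub>"
      using that(3) Q.add.right_cancel[of "h v" "h (u - v)" "\<zero>\<^bsub>Q\<^esub>"] by simp
    with closed show ?thesis by (simp add: kernel_def)
  qed
  have "x \<in> kernel Free (add_monoid Q) h" if "x \<in> relators" for x
    using that
    by (cases rule: relatorsE)
       (simp_all only: diff_diff_add, auto simp del: carrier_free_Abelian_group_iff
        simp: h_add h_of frag_of_in_Free left right balanced rho_closed act_closed
        intro!: kernelI add_in_Free frag_of_in_Free)
  then have "relators \<subseteq> kernel Free (add_monoid Q) h" by blast
  then have "Rel \<subseteq> kernel Free (add_monoid Q) h"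
    unfolding Rel_eq by (rule F.generate_subgroup_incl[OF _ h.subgroup_kernel])
  then obtain f where f: "f \<in> hom (Free Mod Rel) (add_monoid Q)"
    and f_coset: "\<And>u. u \<in> carrier Free \<Longrightarrow> f (Rel #>\<^bsub>Free\<^esub> u) = h u"
    using h.FactGroup_universal_kernel[OF Rel_normal] by blast
  show thesis
    by (rule that[of f]) (use f f_coset h_of in \<open>auto simp: hom_def TP_simps pure_tensor_def\<close>)
qed

text \<open>
  Left multiplication by \<open>c\<close> on formal sums sends each relator to a relator, hence preserves the
  subgroup of relations.  So the image of a coset lies in one coset, which the action then picks.
\<close>

lemma smult_coset:
  assumes c: "c \<in> carrier B" and u: "u \<in> carrier Free"
  defines "E \<equiv> frag_extend (\<lambda>(b, n). frag_of (c \<otimes>\<^bsub>B\<^esub> b, n))"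
  shows "c \<odot>\<^bsub>TP\<^esub> (Rel #>\<^bsub>Free\<^esub> u) = Rel #>\<^bsub>Free\<^esub> E u" and "E u \<in> carrier Free"
proof -
  have E_of: "E (frag_of (b, n)) = frag_of (c \<otimes>\<^bsub>B\<^esub> b, n)" for b n
    by (simp add: E_def)
  have E_add: "E (x + y) = E x + E y" for x y by (simp add: E_def frag_extend_add)
  have E_diff: "E (x - y) = E x - E y" for x y by (simp add: E_def frag_extend_diff)
  have E_closed: "E x \<in> carrier Free" if "x \<in> carrier Free" for x
  proof -
    have "Poly_Mapping.keys (case z of (b, n) \<Rightarrow> frag_of (c \<otimes>\<^bsub>B\<^esub> b, n)) \<subseteq> carrier B \<times> carrier N"
      if "z \<in> carrier B \<times> carrier N" for z :: "'b \<times> 'n"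
      using that c by auto
    then have "(\<Union>z\<in>Poly_Mapping.keys x. Poly_Mapping.keys (case z of (b, n) \<Rightarrow> frag_of (c \<otimes>\<^bsub>B\<^esub> b, n)))
        \<subseteq> carrier B \<times> carrier N"
      using \<open>x \<in> carrier Free\<close> by (intro UN_least) auto
    then have "Poly_Mapping.keys (E x) \<subseteq> carrier B \<times> carrier N"
      unfolding E_def
      by (rule subset_trans[OF keys_frag_extend[of "\<lambda>(b, n). frag_of (c \<otimes>\<^bsub>B\<^esub> b, n)" x]])
    then show ?thesis by (simp only: carrier_free_Abelian_group_iff)
  qed
  show "E u \<in> carrier Free" by (rule E_closed[OF u])
  have "E \<in> hom Free Free"
  proof (rule homI)
    show "E x \<in> carrier Free" if "x \<in> carrier Free" for x
      using that by (rule E_closed)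
    show "E (x \<otimes>\<^bsub>Free\<^esub> y) = E x \<otimes>\<^bsub>Free\<^esub> E y" for x y
      by (simp only: mult_free_Abelian_group E_add)
  qed
  then interpret E: group_hom Free Free E
    by (intro group_hom.intro group_hom_axioms.intro F.is_group)
  have "E ` relators \<subseteq> relators"
  proof (rule image_subsetI)
    fix x assume "x \<in> relators"
    then show "E x \<in> relators"
    proof (cases rule: relatorsE)
      case (left b b' n)
      then have "E x = frag_of (c \<otimes>\<^bsub>B\<^esub> b \<oplus>\<^bsub>B\<^esub> c \<otimes>\<^bsub>B\<^esub> b', n) - frag_of (c \<otimes>\<^bsub>B\<^esub> b, n) - frag_of (c \<otimes>\<^bsub>B\<^esub> b', n)"
        using c by (simp add: E_diff E_of B.r_distr)
      moreover have "c \<otimes>\<^bsub>B\<^esub> b \<in> carrier B" "c \<otimes>\<^bsub>B\<^esub> b' \<in> carrier B" using left c by auto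
      ultimately show ?thesis using left(3) unfolding relators_def by blast
    next
      case (right b n n')
      then have "E x = frag_of (c \<otimes>\<^bsub>B\<^esub> b, n \<oplus>\<^bsub>N\<^esub> n') - frag_of (c \<otimes>\<^bsub>B\<^esub> b, n) - frag_of (c \<otimes>\<^bsub>B\<^esub> b, n')"
        by (simp add: E_diff E_of)
      moreover have "c \<otimes>\<^bsub>B\<^esub> b \<in> carrier B" using right c by auto
      ultimately show ?thesis using right(2,3) unfolding relators_def by blast
    next
      case (balanced b a n)
      then have "E x = frag_of (\<rho> (c \<otimes>\<^bsub>B\<^esub> b) a, n) - frag_of (c \<otimes>\<^bsub>B\<^esub> b, a \<odot>\<^bsub>N\<^esub> n)"
        using c by (simp add: E_diff E_of rho_assoc)
      moreover have "c \<otimes>\<^bsub>B\<^esub> b \<in> carrier B" using balanced c by auto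
      ultimately show ?thesis using balanced(2,3) unfolding relators_def by blast
    qed
  qed
  then have "generate Free (E ` relators) \<subseteq> Rel"
    unfolding Rel_eq by (intro F.mono_generate)
  then have E_Rel: "E t \<in> Rel" if "t \<in> Rel" for t
    using that E.generate_img[OF relators_subset] unfolding Rel_eq by blast
  have "c \<odot>\<^bsub>TP\<^esub> (Rel #>\<^bsub>Free\<^esub> u) = Rel <#>\<^bsub>Free\<^esub> (E ` (Rel #>\<^bsub>Free\<^esub> u))"
    by (simp add: tensor_product_def Let_def E_def)
  also have "\<dots> = Rel #>\<^bsub>Free\<^esub> E u"
  proof (intro equalityI subsetI)
    fix x assume "x \<in> Rel <#>\<^bsub>Free\<^esub> (E ` (Rel #>\<^bsub>Free\<^esub> u))"
    then obtain t t' where t: "t \<in> Rel" "t' \<in> Rel" and "x = t + E (t' + u)"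
      by (auto simp: set_mult_def r_coset_def)
    then have "x = (t + E t') + E u" by (simp add: E_add)
    moreover have "t + E t' \<in> Rel"
      using subgroup.m_closed[OF Rel_subgroup t(1) E_Rel[OF t(2)]] by simp
    ultimately show "x \<in> Rel #>\<^bsub>Free\<^esub> E u" by (auto simp: r_coset_def)
  next
    fix x assume "x \<in> Rel #>\<^bsub>Free\<^esub> E u"
    then obtain t where t: "t \<in> Rel" "x = t + E u" by (auto simp: r_coset_def)
    moreover have "u \<in> Rel #>\<^bsub>Free\<^esub> u" by (rule F.rcos_self[OF u Rel_subgroup])
    ultimately show "x \<in> Rel <#>\<^bsub>Free\<^esub> (E ` (Rel #>\<^bsub>Free\<^esub> u))"
      by (force simp: set_mult_def)
  qed
  finally show "c \<odot>\<^bsub>TP\<^esub> (Rel #>\<^bsub>Free\<^esub> u) = Rel #>\<^bsub>Free\<^esub> E u" .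
qed

lemma smult_tens:
  assumes "c \<in> carrier B" "b \<in> carrier B" "n \<in> carrier N"
  shows "c \<odot>\<^bsub>TP\<^esub> tens b n = tens (c \<otimes>\<^bsub>B\<^esub> b) n"
  using smult_coset(1)[OF assms(1) frag_of_in_Free[OF assms(2,3)]] by (simp add: pure_tensor_def)

lemma TP_smult_closed:
  assumes "c \<in> carrier B" "u \<in> carrier TP"
  shows "c \<odot>\<^bsub>TP\<^esub> u \<in> carrier TP"
  using assms smult_coset[OF assms(1)] by (auto simp: carrier_TP)

lemma TP_smult_add:
  assumes "c \<in> carrier B" "u \<in> carrier TP" "v \<in> carrier TP"
  shows "c \<odot>\<^bsub>TP\<^esub> (u \<oplus>\<^bsub>TP\<^esub> v) = c \<odot>\<^bsub>TP\<^esub> u \<oplus>\<^bsub>TP\<^esub> c \<odot>\<^bsub>TP\<^esub> v"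
proof -
  obtain x y where xy: "x \<in> carrier Free" "y \<in> carrier Free"
    "u = Rel #>\<^bsub>Free\<^esub> x" "v = Rel #>\<^bsub>Free\<^esub> y"
    using assms(2,3) unfolding carrier_TP by blast
  show ?thesis
    unfolding xy(3,4)
    by (simp only: coset_add[symmetric] xy(1,2) smult_coset[OF assms(1)] add_in_Free frag_extend_add)
qed

lemma TP_left_module: "left_module B TP"
proof (intro left_module.intro left_module_axioms.intro)
  show "ring B" by (rule B.ring_axioms)
  show "abelian_group TP" by (rule TP_abelian_group)
next
  fix a b u assume ab: "a \<in> carrier B" "b \<in> carrier B" and u: "u \<in> carrier TP"
  from u show "(a \<oplus>\<^bsub>B\<^esub> b) \<odot>\<^bsub>TP\<^esub> u = a \<odot>\<^bsub>TP\<^esub> u \<oplus>\<^bsub>TP\<^esub> b \<odot>\<^bsub>TP\<^esub> u"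
  proof (induction rule: TP_induct)
    case (tens d n)
    with ab show ?case by (simp add: smult_tens B.l_distr tens_add_left)
  next
    case (add u v)
    with ab show ?case by (simp add: TP_smult_add TP_smult_closed TP.a_ac)
  qed
  from u show "(a \<otimes>\<^bsub>B\<^esub> b) \<odot>\<^bsub>TP\<^esub> u = a \<odot>\<^bsub>TP\<^esub> (b \<odot>\<^bsub>TP\<^esub> u)"
  proof (induction rule: TP_induct)
    case (tens d n)
    with ab show ?case by (simp add: smult_tens B.m_assoc)
  next
    case (add u v)
    with ab show ?case by (simp add: TP_smult_add TP_smult_closed)
  qed
next
  fix u assume "u \<in> carrier TP"
  then show "\<one>\<^bsub>B\<^esub> \<odot>\<^bsub>TP\<^esub> u = u"
    by (induction rule: TP_induct) (simp_all add: smult_tens TP_smult_add)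
qed (auto simp: TP_smult_closed TP_smult_add)

end

section \<open>Modules of homomorphisms\<close>

lemma module_homI:
  assumes "h \<in> carrier M \<rightarrow>\<^sub>E carrier N"
    and "\<And>x y. \<lbrakk>x \<in> carrier M; y \<in> carrier M\<rbrakk> \<Longrightarrow> h (x \<oplus>\<^bsub>M\<^esub> y) = h x \<oplus>\<^bsub>N\<^esub> h y"
    and "\<And>a x. \<lbrakk>a \<in> carrier A; x \<in> carrier M\<rbrakk> \<Longrightarrow> h (a \<odot>\<^bsub>M\<^esub> x) = a \<odot>\<^bsub>N\<^esub> h x"
  shows "h \<in> module_hom A M N"
  using assms by (auto simp: module_hom_def)

lemma module_homD:
  assumes "h \<in> module_hom A M N"
  shows "h \<in> carrier M \<rightarrow>\<^sub>E carrier N"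
    and "x \<in> carrier M \<Longrightarrow> h x \<in> carrier N"
    and "\<lbrakk>x \<in> carrier M; y \<in> carrier M\<rbrakk> \<Longrightarrow> h (x \<oplus>\<^bsub>M\<^esub> y) = h x \<oplus>\<^bsub>N\<^esub> h y"
    and "\<lbrakk>a \<in> carrier A; x \<in> carrier M\<rbrakk> \<Longrightarrow> h (a \<odot>\<^bsub>M\<^esub> x) = a \<odot>\<^bsub>N\<^esub> h x"
  using assms by (auto simp: module_hom_def)

lemma module_hom_eqI:
  assumes "h \<in> module_hom A M N" "k \<in> module_hom A M N" "\<And>x. x \<in> carrier M \<Longrightarrow> h x = k x"
  shows "h = k"
  using module_homD(1)[OF assms(1)] module_homD(1)[OF assms(2)] assms(3) by (rule PiE_ext)

lemma hom_module_simps: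
  "carrier (hom_module A M N) = module_hom A M N"
  "h \<oplus>\<^bsub>hom_module A M N\<^esub> k = (\<lambda>x\<in>carrier M. h x \<oplus>\<^bsub>N\<^esub> k x)"
  "r \<odot>\<^bsub>hom_module A M N\<^esub> h = (\<lambda>x\<in>carrier M. (r \<odot>\<^bsub>A\<^esub> \<one>\<^bsub>A\<^esub>) \<odot>\<^bsub>N\<^esub> h x)"
  by (simp_all add: hom_module_def)

lemma module_hom_add_closed:
  assumes M: "left_module A M" and N: "left_module A N"
    and h: "h \<in> module_hom A M N" and k: "k \<in> module_hom A M N"
  shows "(\<lambda>x\<in>carrier M. h x \<oplus>\<^bsub>N\<^esub> k x) \<in> module_hom A M N"
proof -
  interpret M: left_module A M by fact
  interpret N: left_module A N by fact
  show ?thesis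
    by (rule module_homI)
       (simp_all add: module_homD(2-4)[OF h] module_homD(2-4)[OF k] N.smult_r_distr N.a_ac)
qed

text \<open>
  For central \<open>c\<close>, \<open>c h(a x) = c a h(x) = a c h(x)\<close>.
\<close>

lemma module_hom_smult_closed:
  assumes M: "left_module A M" and N: "left_module A N"
    and c: "c \<in> carrier A" "\<And>a. a \<in> carrier A \<Longrightarrow> c \<otimes>\<^bsub>A\<^esub> a = a \<otimes>\<^bsub>A\<^esub> c"
    and h: "h \<in> module_hom A M N"
  shows "(\<lambda>x\<in>carrier M. c \<odot>\<^bsub>N\<^esub> h x) \<in> module_hom A M N"
proof -
  interpret M: left_module A M by fact
  interpret N: left_module A N by fact
  have "c \<odot>\<^bsub>N\<^esub> (a \<odot>\<^bsub>N\<^esub> h x) = a \<odot>\<^bsub>N\<^esub> (c \<odot>\<^bsub>N\<^esub> h x)" if "a \<in> carrier A" "x \<in> carrier M" for a x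
    using that c module_homD(2)[OF h] by (simp add: N.smult_assoc1[symmetric])
  then show ?thesis
    by (intro module_homI)
       (simp_all add: module_homD(2-4)[OF h] N.smult_r_distr c(1))
qed

text \<open>
  The criterion asks for pointwise identities; that \<open>\<Phi>\<close> has values in extensional functions turns
  them into equations between homomorphisms.  The closure conditions on the source are there because
  \<open>hom_module\<close> is defined for arbitrary records, where sums and multiples need not be linear.
\<close>

lemma hom_module_isomorphicI:
  assumes closed: "\<And>f. f \<in> module_hom A M N \<Longrightarrow> \<Phi> f \<in> module_hom A' M' N'"
    and sum: "\<And>f g. \<lbrakk>f \<in> module_hom A M N; g \<in> module_hom A M N\<rbrakk>
        \<Longrightarrow> (\<lambda>x\<in>carrier M. f x \<oplus>\<^bsub>N\<^esub> g x) \<in> module_hom A M N"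
    and scaled: "\<And>r f. \<lbrakk>r \<in> carrier R; f \<in> module_hom A M N\<rbrakk>
        \<Longrightarrow> (\<lambda>x\<in>carrier M. (r \<odot>\<^bsub>A\<^esub> \<one>\<^bsub>A\<^esub>) \<odot>\<^bsub>N\<^esub> f x) \<in> module_hom A M N"
    and add: "\<And>f g w. \<lbrakk>f \<in> module_hom A M N; g \<in> module_hom A M N; w \<in> carrier M'\<rbrakk>
        \<Longrightarrow> \<Phi> (\<lambda>x\<in>carrier M. f x \<oplus>\<^bsub>N\<^esub> g x) w = \<Phi> f w \<oplus>\<^bsub>N'\<^esub> \<Phi> g w"
    and smult: "\<And>r f w. \<lbrakk>r \<in> carrier R; f \<in> module_hom A M N; w \<in> carrier M'\<rbrakk>
        \<Longrightarrow> \<Phi> (\<lambda>x\<in>carrier M. (r \<odot>\<^bsub>A\<^esub> \<one>\<^bsub>A\<^esub>) \<odot>\<^bsub>N\<^esub> f x) w = (r \<odot>\<^bsub>A'\<^esub> \<one>\<^bsub>A'\<^esub>) \<odot>\<^bsub>N'\<^esub> \<Phi> f w"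
    and inj: "\<And>f g. \<lbrakk>f \<in> module_hom A M N; g \<in> module_hom A M N; \<Phi> f = \<Phi> g\<rbrakk> \<Longrightarrow> f = g"
    and surj: "\<And>h. h \<in> module_hom A' M' N' \<Longrightarrow> \<exists>f\<in>module_hom A M N. \<Phi> f = h"
  shows "module_isomorphic R (hom_module A M N) (hom_module A' M' N')"
proof -
  let ?\<Psi> = "\<lambda>f\<in>module_hom A M N. \<Phi> f"
  have ext: "\<Phi> f = (\<lambda>x\<in>carrier M'. \<Phi> f x)" if "f \<in> module_hom A M N" for f
    using module_homD(1)[OF closed[OF that]] by (simp add: PiE_def extensional_restrict)
  have "?\<Psi> \<in> module_hom R (hom_module A M N) (hom_module A' M' N')"
  proof (rule module_homI; unfold hom_module_simps)
    show "?\<Psi> \<in> module_hom A M N \<rightarrow>\<^sub>E module_hom A' M' N'" using closed by auto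
  next
    fix f g assume fg: "f \<in> module_hom A M N" "g \<in> module_hom A M N"
    have "\<Phi> (\<lambda>x\<in>carrier M. f x \<oplus>\<^bsub>N\<^esub> g x) = (\<lambda>x\<in>carrier M'. \<Phi> f x \<oplus>\<^bsub>N'\<^esub> \<Phi> g x)"
      by (subst ext[OF sum[OF fg]]) (simp add: add[OF fg] cong: restrict_cong)
    with fg sum show "?\<Psi> (\<lambda>x\<in>carrier M. f x \<oplus>\<^bsub>N\<^esub> g x) = (\<lambda>x\<in>carrier M'. ?\<Psi> f x \<oplus>\<^bsub>N'\<^esub> ?\<Psi> g x)"
      by simp
  next
    fix r f assume rf: "r \<in> carrier R" "f \<in> module_hom A M N"
    have "\<Phi> (\<lambda>x\<in>carrier M. (r \<odot>\<^bsub>A\<^esub> \<one>\<^bsub>A\<^esub>) \<odot>\<^bsub>N\<^esub> f x)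
        = (\<lambda>x\<in>carrier M'. (r \<odot>\<^bsub>A'\<^esub> \<one>\<^bsub>A'\<^esub>) \<odot>\<^bsub>N'\<^esub> \<Phi> f x)"
      by (subst ext[OF scaled[OF rf]]) (simp add: smult[OF rf] cong: restrict_cong)
    with rf scaled show "?\<Psi> (\<lambda>x\<in>carrier M. (r \<odot>\<^bsub>A\<^esub> \<one>\<^bsub>A\<^esub>) \<odot>\<^bsub>N\<^esub> f x)
        = (\<lambda>x\<in>carrier M'. (r \<odot>\<^bsub>A'\<^esub> \<one>\<^bsub>A'\<^esub>) \<odot>\<^bsub>N'\<^esub> ?\<Psi> f x)"
      by simp
  qed
  moreover have "bij_betw ?\<Psi> (module_hom A M N) (module_hom A' M' N')"
  proof (rule bij_betw_imageI)
    show "inj_on ?\<Psi> (module_hom A M N)" using inj by (auto intro!: inj_onI)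
    show "?\<Psi> ` module_hom A M N = module_hom A' M' N'" using closed surj by fastforce
  qed
  ultimately show ?thesis
    unfolding module_isomorphic_def hom_module_simps by (intro bexI[where x = ?\<Psi>])
qed

section \<open>Induction is left adjoint to restriction\<close>

locale induction = group_algebra_hom R G G\<^sub>1 \<phi> +
    V: left_module "group_ring R G" V + V1: left_module "group_ring R G\<^sub>1" V\<^sub>1
  for R :: "('r, 'c) ring_scheme" (structure) and G :: "('g, 'd) monoid_scheme"
    and G\<^sub>1 :: "('h, 'e) monoid_scheme" and \<phi> :: "'g \<Rightarrow> 'h"
    and V :: "('g \<Rightarrow> 'r, 'v, 'f) module_scheme"
    and V\<^sub>1 :: "('h \<Rightarrow> 'r, 'u, 'k) module_scheme"
begin

sublocale I: tensor "group_ring R G\<^sub>1" "\<lambda>b a. b \<otimes>\<^bsub>group_ring R G\<^sub>1\<^esub> map_RG a" "group_ring R G" V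
proof
  fix a b c
  assume "c \<in> carrier G1.RG" "b \<in> carrier G1.RG" "a \<in> carrier G.RG"
  then show "c \<otimes>\<^bsub>G1.RG\<^esub> (b \<otimes>\<^bsub>G1.RG\<^esub> map_RG a) = c \<otimes>\<^bsub>G1.RG\<^esub> b \<otimes>\<^bsub>G1.RG\<^esub> map_RG a"
    by (simp add: V1.m_assoc map_RG_closed)
qed (simp_all add: map_RG_closed)

sublocale I: left_module "group_ring R G\<^sub>1" I.TP
  by (rule I.TP_left_module)

lemma Ind_eq: "Ind R G G\<^sub>1 \<phi> V = I.TP"
  by (simp add: Ind_def)

lemma Res_simps:
  "carrier (Res R G G\<^sub>1 \<phi> V\<^sub>1) = carrier V\<^sub>1" "add (Res R G G\<^sub>1 \<phi> V\<^sub>1) = add V\<^sub>1"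
  "a \<odot>\<^bsub>Res R G G\<^sub>1 \<phi> V\<^sub>1\<^esub> v = map_RG a \<odot>\<^bsub>V\<^sub>1\<^esub> v"
  by (simp_all add: Res_def)

lemma tens_by_one:
  "\<lbrakk>b \<in> carrier G1.RG; v \<in> carrier V\<rbrakk> \<Longrightarrow> I.tens b v = b \<odot>\<^bsub>I.TP\<^esub> I.tens \<one>\<^bsub>G1.RG\<^esub> v"
  by (simp add: I.smult_tens)

text \<open>
  A homomorphism on \<open>Ind V\<close> is determined by its values on \<open>1 \<otimes> v\<close> because \<open>b \<otimes> v = b (1 \<otimes> v)\<close>.
  Conversely \<open>b \<otimes> v \<mapsto> b h(v)\<close> is balanced exactly because \<open>h\<close> is linear for the action of \<open>RG\<close> on
  \<open>V\<^sub>1\<close> through \<open>\<phi>\<close>.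
\<close>

lemma Ind_Res_adjunction:
  "module_isomorphic R (hom_module G1.RG (Ind R G G\<^sub>1 \<phi> V) V\<^sub>1) (hom_module G.RG V (Res R G G\<^sub>1 \<phi> V\<^sub>1))"
  unfolding Ind_eq
proof (rule hom_module_isomorphicI[where \<Phi> = "\<lambda>f. \<lambda>v\<in>carrier V. f (I.tens \<one>\<^bsub>G1.RG\<^esub> v)"])
  fix f assume f: "f \<in> module_hom G1.RG I.TP V\<^sub>1"
  have "f (I.tens \<one>\<^bsub>G1.RG\<^esub> (a \<odot>\<^bsub>V\<^esub> v)) = map_RG a \<odot>\<^bsub>V\<^sub>1\<^esub> f (I.tens \<one>\<^bsub>G1.RG\<^esub> v)"
    if "a \<in> carrier G.RG" "v \<in> carrier V" for a v
    using I.tens_balanced[of "\<one>\<^bsub>G1.RG\<^esub>" a v] tens_by_one[of "map_RG a" v] that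
      module_homD(4)[OF f, of "map_RG a" "I.tens \<one>\<^bsub>G1.RG\<^esub> v"]
    by (simp add: map_RG_closed)
  then show "(\<lambda>v\<in>carrier V. f (I.tens \<one>\<^bsub>G1.RG\<^esub> v)) \<in> module_hom G.RG V (Res R G G\<^sub>1 \<phi> V\<^sub>1)"
    by (intro module_homI) (simp_all add: Res_simps module_homD[OF f] I.tens_add_right)
  fix g assume g: "g \<in> module_hom G1.RG I.TP V\<^sub>1"
  show "(\<lambda>x\<in>carrier I.TP. f x \<oplus>\<^bsub>V\<^sub>1\<^esub> g x) \<in> module_hom G1.RG I.TP V\<^sub>1"
    by (rule module_hom_add_closed[OF I.TP_left_module V1.left_module_axioms f g])
  assume eq: "(\<lambda>v\<in>carrier V. f (I.tens \<one>\<^bsub>G1.RG\<^esub> v)) = (\<lambda>v\<in>carrier V. g (I.tens \<one>\<^bsub>G1.RG\<^esub> v))"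
  show "f = g"
  proof (rule module_hom_eqI[OF f g])
    fix u assume "u \<in> carrier I.TP"
    then show "f u = g u"
    proof (induction rule: I.TP_induct)
      case (tens b v)
      with fun_cong[OF eq, of v] show ?case
        by (simp add: tens_by_one[of b v] module_homD(4)[OF f] module_homD(4)[OF g])
    next
      case (add u w)
      then show ?case by (simp add: module_homD(3)[OF f] module_homD(3)[OF g])
    qed
  qed
next
  fix r f assume r: "r \<in> carrier R" and f: "f \<in> module_hom G1.RG I.TP V\<^sub>1"
  show "(\<lambda>x\<in>carrier I.TP. (r \<odot>\<^bsub>G1.RG\<^esub> \<one>\<^bsub>G1.RG\<^esub>) \<odot>\<^bsub>V\<^sub>1\<^esub> f x) \<in> module_hom G1.RG I.TP V\<^sub>1"
    by (rule module_hom_smult_closed[OF I.TP_left_module V1.left_module_axioms _ _ f])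
       (simp_all add: r G1.scalar_one G1.scalar_central)
next
  fix h assume h: "h \<in> module_hom G.RG V (Res R G G\<^sub>1 \<phi> V\<^sub>1)"
  note h = module_homD[OF h, unfolded Res_simps]
  obtain f where f: "f \<in> hom (add_monoid I.TP) (add_monoid V\<^sub>1)"
    and f_tens: "\<And>b v. \<lbrakk>b \<in> carrier G1.RG; v \<in> carrier V\<rbrakk> \<Longrightarrow> f (I.tens b v) = b \<odot>\<^bsub>V\<^sub>1\<^esub> h v"
    by (rule I.TP_universal[of V\<^sub>1 "\<lambda>b v. b \<odot>\<^bsub>V\<^sub>1\<^esub> h v"])
       (auto simp: V1.abelian_group_axioms h V1.smult_l_distr V1.smult_r_distr V1.smult_assoc1
          map_RG_closed)
  have f_closed: "f u \<in> carrier V\<^sub>1" if "u \<in> carrier I.TP" for u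
    using f that by (auto simp: hom_def)
  have f_add: "f (u \<oplus>\<^bsub>I.TP\<^esub> w) = f u \<oplus>\<^bsub>V\<^sub>1\<^esub> f w" if "u \<in> carrier I.TP" "w \<in> carrier I.TP" for u w
    using f that by (auto simp: hom_def)
  have f_smult: "f (c \<odot>\<^bsub>I.TP\<^esub> u) = c \<odot>\<^bsub>V\<^sub>1\<^esub> f u" if c: "c \<in> carrier G1.RG" and "u \<in> carrier I.TP" for c u
    using that(2)
  proof (induction rule: I.TP_induct)
    case (tens b v)
    with c show ?case by (simp add: I.smult_tens f_tens V1.smult_assoc1 h)
  next
    case (add u w)
    with c show ?case by (simp add: I.smult_r_distr f_add V1.smult_r_distr f_closed)
  qed
  show "\<exists>f\<in>module_hom G1.RG I.TP V\<^sub>1. (\<lambda>v\<in>carrier V. f (I.tens \<one>\<^bsub>G1.RG\<^esub> v)) = h"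
  proof (rule bexI[where x = "\<lambda>u\<in>carrier I.TP. f u"])
    show "(\<lambda>u\<in>carrier I.TP. f u) \<in> module_hom G1.RG I.TP V\<^sub>1"
      by (rule module_homI) (simp_all add: f_closed f_add f_smult)
    show "(\<lambda>v\<in>carrier V. (\<lambda>u\<in>carrier I.TP. f u) (I.tens \<one>\<^bsub>G1.RG\<^esub> v)) = h"
      by (rule PiE_ext[OF _ h(1)]) (auto simp: f_tens h)
  qed
qed (simp_all add: Res_simps G.scalar_one G1.scalar_one map_RG_mnl phi_one)

end

section \<open>Relative projectivity and sections of the trace\<close>

lemma (in left_module) direct_summand_projection:
  assumes "direct_summand H A M"
  obtains \<pi> where "\<And>x. x \<in> carrier M \<Longrightarrow> \<pi> x \<in> H"
    and "\<And>x y. \<lbrakk>x \<in> carrier M; y \<in> carrier M\<rbrakk> \<Longrightarrow> \<pi> (x \<oplus>\<^bsub>M\<^esub> y) = \<pi> x \<oplus>\<^bsub>M\<^esub> \<pi> y"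
    and "\<And>a x. \<lbrakk>a \<in> carrier A; x \<in> carrier M\<rbrakk> \<Longrightarrow> \<pi> (a \<odot>\<^bsub>M\<^esub> x) = a \<odot>\<^bsub>M\<^esub> \<pi> x"
    and "\<And>x. x \<in> H \<Longrightarrow> \<pi> x = x"
proof -
  obtain H' where H: "submodule H A M" and H': "submodule H' A M"
    and inter: "H \<inter> H' = {\<zero>\<^bsub>M\<^esub>}" and sum: "H <+>\<^bsub>M\<^esub> H' = carrier M"
    using assms unfolding direct_summand_def by blast
  interpret H: submodule H A M by (rule H)
  interpret H': submodule H' A M by (rule H')
  have HM: "x \<in> carrier M" if "x \<in> H" for x using H.subset that by auto
  have H'M: "x \<in> carrier M" if "x \<in> H'" for x using H'.subset that by auto
  have H_minus: "\<ominus>\<^bsub>M\<^esub> x \<in> H" if "x \<in> H" for x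
    using H.m_inv_closed[OF that] by (simp add: a_inv_def)
  have H'_minus: "\<ominus>\<^bsub>M\<^esub> x \<in> H'" if "x \<in> H'" for x
    using H'.m_inv_closed[OF that] by (simp add: a_inv_def)
  have H_add: "x \<oplus>\<^bsub>M\<^esub> y \<in> H" if "x \<in> H" "y \<in> H" for x y
    using H.m_closed[OF that] by simp
  have H'_add: "x \<oplus>\<^bsub>M\<^esub> y \<in> H'" if "x \<in> H'" "y \<in> H'" for x y
    using H'.m_closed[OF that] by simp
  have unique: "a = c" if "a \<in> H" "c \<in> H" "b \<in> H'" "d \<in> H'" "a \<oplus>\<^bsub>M\<^esub> b = c \<oplus>\<^bsub>M\<^esub> d" for a b c d
  proof -
    note M = HM[OF that(1)] HM[OF that(2)] H'M[OF that(3)] H'M[OF that(4)]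
    have "\<ominus>\<^bsub>M\<^esub> c \<oplus>\<^bsub>M\<^esub> a = \<ominus>\<^bsub>M\<^esub> c \<oplus>\<^bsub>M\<^esub> (a \<oplus>\<^bsub>M\<^esub> b) \<oplus>\<^bsub>M\<^esub> \<ominus>\<^bsub>M\<^esub> b"
      using M by (simp add: M.a_assoc M.r_neg)
    also have "\<dots> = d \<oplus>\<^bsub>M\<^esub> \<ominus>\<^bsub>M\<^esub> b"
      unfolding that(5) using M by (simp add: M.a_assoc[symmetric] M.l_neg)
    finally have "\<ominus>\<^bsub>M\<^esub> c \<oplus>\<^bsub>M\<^esub> a \<in> H \<inter> H'"
      using H_add[OF H_minus[OF that(2)] that(1)] H'_add[OF that(4) H'_minus[OF that(3)]] by simp
    then have "\<ominus>\<^bsub>M\<^esub> c \<oplus>\<^bsub>M\<^esub> a = \<ominus>\<^bsub>M\<^esub> c \<oplus>\<^bsub>M\<^esub> c" unfolding inter using M by (simp add: M.l_neg)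
    then show "a = c" using M by simp
  qed
  define \<pi> where "\<pi> x = (SOME a. a \<in> H \<and> (\<exists>b\<in>H'. x = a \<oplus>\<^bsub>M\<^esub> b))" for x
  have \<pi>: "\<pi> x \<in> H" "\<exists>b\<in>H'. x = \<pi> x \<oplus>\<^bsub>M\<^esub> b" if "x \<in> carrier M" for x
  proof -
    have "x \<in> H <+>\<^bsub>M\<^esub> H'" using that sum by simp
    then have "\<exists>a. a \<in> H \<and> (\<exists>b\<in>H'. x = a \<oplus>\<^bsub>M\<^esub> b)"
      unfolding set_add_def' by blast
    from someI_ex[OF this] show "\<pi> x \<in> H" "\<exists>b\<in>H'. x = \<pi> x \<oplus>\<^bsub>M\<^esub> b"
      by (auto simp: \<pi>_def)
  qed
  have \<pi>_eqI: "\<pi> x = a" if "x = a \<oplus>\<^bsub>M\<^esub> b" "a \<in> H" "b \<in> H'" for x a b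
  proof -
    have "x \<in> carrier M" using that HM H'M by simp
    from \<pi>[OF this] obtain b' where b': "\<pi> x \<in> H" "b' \<in> H'" "x = \<pi> x \<oplus>\<^bsub>M\<^esub> b'" by blast
    show ?thesis by (rule unique[OF b'(1) that(2) b'(2) that(3)]) (use b'(3) that(1) in simp)
  qed
  show thesis
  proof (rule that[of \<pi>])
    fix x assume x: "x \<in> carrier M"
    show "\<pi> x \<in> H" by (rule \<pi>(1)[OF x])
    obtain b where b: "b \<in> H'" "x = \<pi> x \<oplus>\<^bsub>M\<^esub> b" using \<pi>(2)[OF x] by blast
    show "\<pi> (a \<odot>\<^bsub>M\<^esub> x) = a \<odot>\<^bsub>M\<^esub> \<pi> x" if "a \<in> carrier A" for a
    proof (rule \<pi>_eqI)
      show "a \<odot>\<^bsub>M\<^esub> x = a \<odot>\<^bsub>M\<^esub> \<pi> x \<oplus>\<^bsub>M\<^esub> a \<odot>\<^bsub>M\<^esub> b"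
        by (subst b(2)) (rule smult_r_distr[OF that HM[OF \<pi>(1)[OF x]] H'M[OF b(1)]])
    qed (use that b(1) \<pi>(1)[OF x] in auto)
    fix y assume y: "y \<in> carrier M"
    obtain c where c: "c \<in> H'" "y = \<pi> y \<oplus>\<^bsub>M\<^esub> c" using \<pi>(2)[OF y] by blast
    show "\<pi> (x \<oplus>\<^bsub>M\<^esub> y) = \<pi> x \<oplus>\<^bsub>M\<^esub> \<pi> y"
    proof (rule \<pi>_eqI)
      have "x \<oplus>\<^bsub>M\<^esub> y = (\<pi> x \<oplus>\<^bsub>M\<^esub> b) \<oplus>\<^bsub>M\<^esub> (\<pi> y \<oplus>\<^bsub>M\<^esub> c)"
        by (simp only: b(2)[symmetric] c(2)[symmetric])
      also have "\<dots> = (\<pi> x \<oplus>\<^bsub>M\<^esub> \<pi> y) \<oplus>\<^bsub>M\<^esub> (b \<oplus>\<^bsub>M\<^esub> c)"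
        using HM[OF \<pi>(1)[OF x]] HM[OF \<pi>(1)[OF y]] H'M[OF b(1)] H'M[OF c(1)] by (simp add: M.a_ac)
      finally show "x \<oplus>\<^bsub>M\<^esub> y = (\<pi> x \<oplus>\<^bsub>M\<^esub> \<pi> y) \<oplus>\<^bsub>M\<^esub> (b \<oplus>\<^bsub>M\<^esub> c)" .
    qed (use b c \<pi>(1)[OF x] \<pi>(1)[OF y] H_add H'_add in auto)
  next
    fix x assume "x \<in> H"
    then show "\<pi> x = x"
      using HM H'.one_closed by (intro \<pi>_eqI[of _ _ "\<zero>\<^bsub>M\<^esub>"]) auto
  qed
qed

context finite_group_algebra
begin

lemma scale_mnl:
  "\<lbrakk>r \<in> carrier R; s \<in> carrier R\<rbrakk> \<Longrightarrow> r \<odot>\<^bsub>RG\<^esub> mnl s g = mnl (r \<otimes> s) g"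
  by (rule RG_eqI) (auto simp: RG_smult mnl_eval)

lemma mnl_add:
  "\<lbrakk>r \<in> carrier R; s \<in> carrier R\<rbrakk> \<Longrightarrow> mnl (r \<oplus> s) g = mnl r g \<oplus>\<^bsub>RG\<^esub> mnl s g"
  by (rule RG_eqI) (auto simp: RG_add RG_add_closed mnl_eval)

text \<open>
  In \<open>RG \<otimes>\<^bsub>R\<^esub> V\<^sub>0\<close> let \<open>\<theta> (b \<otimes> v) = b(1) \<otimes> v\<close> keep the component at the neutral element.  Conjugating
  by \<open>g\<close> gives the component at \<open>g\<close>, since \<open>(g\<^bsup>-1\<^esup> b)(1) = b(g)\<close>, and all components add up to the identity.
\<close>

lemma extended_module_trace_section:
  assumes V\<^sub>0: "Module.module R V\<^sub>0"
  defines "W \<equiv> tensor_product RG (\<lambda>b r. r \<odot>\<^bsub>RG\<^esub> b) R V\<^sub>0"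
  shows "left_module RG W"
    and "\<exists>\<theta>\<in>hom (add_monoid W) (add_monoid W). \<forall>w\<in>carrier W.
      (\<Oplus>\<^bsub>W\<^esub>g\<in>carrier G. mnl \<one> g \<odot>\<^bsub>W\<^esub> \<theta> (mnl \<one> (inv\<^bsub>G\<^esub> g) \<odot>\<^bsub>W\<^esub> w)) = w"
proof -
  interpret V0: Module.module R V\<^sub>0 by fact
  interpret RG: ring RG by (rule RG_ring)
  interpret W: tensor RG "\<lambda>b r. r \<odot>\<^bsub>RG\<^esub> b" R V\<^sub>0
  proof
    fix b c r assume bcr: "b \<in> carrier RG" "c \<in> carrier RG" "r \<in> carrier R"
    show "c \<otimes>\<^bsub>RG\<^esub> (r \<odot>\<^bsub>RG\<^esub> b) = r \<odot>\<^bsub>RG\<^esub> (c \<otimes>\<^bsub>RG\<^esub> b)"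
      using bcr(1)
    proof (induction b rule: RG_induct)
      case (monomial s g)
      show ?case
        by (rule RG_eqI)
           (use monomial bcr in \<open>auto simp: scale_mnl RG_mult_closed RG_smult mult_mnl_eval RG_eval R.m_ac\<close>)
    next
      case (add a b)
      have "r \<odot>\<^bsub>RG\<^esub> (a \<oplus>\<^bsub>RG\<^esub> b) = r \<odot>\<^bsub>RG\<^esub> a \<oplus>\<^bsub>RG\<^esub> r \<odot>\<^bsub>RG\<^esub> b"
        if "a \<in> carrier RG" "b \<in> carrier RG" for a b
        by (rule RG_eqI) (use bcr that in \<open>auto simp: RG_smult RG_add RG_add_closed RG_eval R.r_distr\<close>)
      with add bcr show ?case by (simp add: RG_r_distr RG_add_closed RG_mult_closed)
    qed
  qed auto
  show "left_module RG W" unfolding W_def by (rule W.TP_left_module)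
  interpret W': left_module RG W.TP by (rule W.TP_left_module)
  obtain \<theta> where \<theta>: "\<theta> \<in> hom (add_monoid W.TP) (add_monoid W.TP)"
    and \<theta>_tens: "\<And>b v. \<lbrakk>b \<in> carrier RG; v \<in> carrier V\<^sub>0\<rbrakk> \<Longrightarrow> \<theta> (W.tens b v) = W.tens (mnl (b \<one>\<^bsub>G\<^esub>) \<one>\<^bsub>G\<^esub>) v"
  proof (rule W.TP_universal[of W.TP "\<lambda>b v. W.tens (mnl (b \<one>\<^bsub>G\<^esub>) \<one>\<^bsub>G\<^esub>) v"])
    fix b r v assume "b \<in> carrier RG" "r \<in> carrier R" "v \<in> carrier V\<^sub>0"
    then show "W.tens (mnl ((r \<odot>\<^bsub>RG\<^esub> b) \<one>\<^bsub>G\<^esub>) \<one>\<^bsub>G\<^esub>) v = W.tens (mnl (b \<one>\<^bsub>G\<^esub>) \<one>\<^bsub>G\<^esub>) (r \<odot>\<^bsub>V\<^sub>0\<^esub> v)"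
      using W.tens_balanced[of "mnl (b \<one>\<^bsub>G\<^esub>) \<one>\<^bsub>G\<^esub>" r v]
      by (simp add: RG_smult scale_mnl RG_eval)
  qed (auto simp: W.TP_abelian_group RG_eval RG_add mnl_add W.tens_add_left W.tens_add_right)
  have \<theta>_closed: "\<theta> w \<in> carrier W.TP" if "w \<in> carrier W.TP" for w
    using \<theta> that by (auto simp: hom_def)
  have \<theta>_add: "\<theta> (u \<oplus>\<^bsub>W.TP\<^esub> w) = \<theta> u \<oplus>\<^bsub>W.TP\<^esub> \<theta> w" if "u \<in> carrier W.TP" "w \<in> carrier W.TP" for u w
    using \<theta> that by (auto simp: hom_def)
  let ?t = "\<lambda>w g. mnl \<one> g \<odot>\<^bsub>W.TP\<^esub> \<theta> (mnl \<one> (inv\<^bsub>G\<^esub> g) \<odot>\<^bsub>W.TP\<^esub> w)"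
  have "(\<Oplus>\<^bsub>W.TP\<^esub>g\<in>carrier G. ?t w g) = w" if "w \<in> carrier W.TP" for w
    using that
  proof (induction w rule: W.TP_induct)
    case (tens b v)
    have mons: "(\<lambda>g. mnl (b g) g) \<in> carrier G \<rightarrow> carrier RG" using tens by (auto simp: RG_eval)
    have "?t (W.tens b v) g = W.tens (mnl (b g) g) v" if "g \<in> carrier G" for g
      using tens that
      by (simp add: W.smult_tens \<theta>_tens RG_mult_closed RG_eval mnl_mult_eval mnl_mult_mnl)
    then have "(\<Oplus>\<^bsub>W.TP\<^esub>g\<in>carrier G. ?t (W.tens b v) g) = (\<Oplus>\<^bsub>W.TP\<^esub>g\<in>carrier G. W.tens (mnl (b g) g) v)"
      using tens mons by (intro W.TP.finsum_cong') auto
    also have "\<dots> = W.tens (\<Oplus>\<^bsub>RG\<^esub>g\<in>carrier G. mnl (b g) g) v"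
      by (rule additive_map_finsum[OF RG_abelian_group W.TP_abelian_group W.tens_left_additive, symmetric])
         (use tens mons finite_group in auto)
    finally show ?case by (simp only: RG_monomial_sum[OF tens(1), symmetric])
  next
    case (add u w)
    have "(\<Oplus>\<^bsub>W.TP\<^esub>g\<in>carrier G. ?t (u \<oplus>\<^bsub>W.TP\<^esub> w) g) = (\<Oplus>\<^bsub>W.TP\<^esub>g\<in>carrier G. ?t u g \<oplus>\<^bsub>W.TP\<^esub> ?t w g)"
      using add.hyps
      by (intro W.TP.finsum_cong') (auto simp: W'.smult_r_distr \<theta>_add \<theta>_closed)
    also have "\<dots> = (\<Oplus>\<^bsub>W.TP\<^esub>g\<in>carrier G. ?t u g) \<oplus>\<^bsub>W.TP\<^esub> (\<Oplus>\<^bsub>W.TP\<^esub>g\<in>carrier G. ?t w g)"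
      using add.hyps by (intro W.TP.finsum_addf) (auto simp: \<theta>_closed)
    finally show ?case by (simp only: add.IH)
  qed
  with \<theta> show "\<exists>\<theta>\<in>hom (add_monoid W) (add_monoid W). \<forall>w\<in>carrier W.
      (\<Oplus>\<^bsub>W\<^esub>g\<in>carrier G. mnl \<one> g \<odot>\<^bsub>W\<^esub> \<theta> (mnl \<one> (inv\<^bsub>G\<^esub> g) \<odot>\<^bsub>W\<^esub> w)) = w"
    unfolding W_def by (intro bexI[of _ \<theta>]) auto
qed

text \<open>
  If \<open>X\<close> is the direct summand \<open>H\<close> of \<open>W = RG \<otimes>\<^bsub>R\<^esub> V\<^sub>0\<close>, the map \<open>\<theta>\<close> of \<open>W\<close> is compressed to \<open>X\<close> by the
  embedding \<open>h\<close> and the projection \<open>\<pi>\<close>.  Both commute with \<open>G\<close>, so the sum over the conjugates is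
  compressed in the same way, and the identity of \<open>W\<close> compresses to the identity of \<open>X\<close>.
\<close>

lemma relatively_1_projective_trace_section:
  assumes X: "abelian_group X"
    and X_closed: "\<And>a x. \<lbrakk>a \<in> carrier RG; x \<in> carrier X\<rbrakk> \<Longrightarrow> a \<odot>\<^bsub>X\<^esub> x \<in> carrier X"
    and proj: "relatively_1_projective TYPE('w) R G X"
  obtains \<theta> where "\<theta> \<in> hom (add_monoid X) (add_monoid X)"
    and "\<And>x. x \<in> carrier X
      \<Longrightarrow> (\<Oplus>\<^bsub>X\<^esub>g\<in>carrier G. mnl \<one> g \<odot>\<^bsub>X\<^esub> \<theta> (mnl \<one> (inv\<^bsub>G\<^esub> g) \<odot>\<^bsub>X\<^esub> x)) = x"
proof -
  interpret X: abelian_group X by fact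
  obtain V\<^sub>0 :: "('r, 'w) module" and H where V\<^sub>0: "Module.module R V\<^sub>0"
    and H: "direct_summand H RG (tensor_product RG (\<lambda>b r. r \<odot>\<^bsub>RG\<^esub> b) R V\<^sub>0)"
    and iso: "module_isomorphic RG X ((tensor_product RG (\<lambda>b r. r \<odot>\<^bsub>RG\<^esub> b) R V\<^sub>0)\<lparr>carrier := H\<rparr>)"
    using proj unfolding relatively_1_projective_def Let_def by blast
  define W where "W = tensor_product RG (\<lambda>b r. r \<odot>\<^bsub>RG\<^esub> b) R V\<^sub>0"
  note H = H[folded W_def] and iso = iso[folded W_def]
  interpret W: left_module RG W
    unfolding W_def by (rule extended_module_trace_section(1)[OF V\<^sub>0])
  obtain \<theta> where \<theta>: "\<theta> \<in> hom (add_monoid W) (add_monoid W)"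
    and trace: "\<And>w. w \<in> carrier W
      \<Longrightarrow> (\<Oplus>\<^bsub>W\<^esub>g\<in>carrier G. mnl \<one> g \<odot>\<^bsub>W\<^esub> \<theta> (mnl \<one> (inv\<^bsub>G\<^esub> g) \<odot>\<^bsub>W\<^esub> w)) = w"
    using extended_module_trace_section(2)[OF V\<^sub>0] unfolding W_def by blast
  have \<theta>_closed: "\<theta> w \<in> carrier W" if "w \<in> carrier W" for w
    using \<theta> that by (auto simp: hom_def)
  have \<theta>_add: "\<theta> (u \<oplus>\<^bsub>W\<^esub> w) = \<theta> u \<oplus>\<^bsub>W\<^esub> \<theta> w" if "u \<in> carrier W" "w \<in> carrier W" for u w
    using \<theta> that by (auto simp: hom_def)
  obtain \<pi> where \<pi>: "\<And>x. x \<in> carrier W \<Longrightarrow> \<pi> x \<in> H"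
    and \<pi>_add: "\<And>x y. \<lbrakk>x \<in> carrier W; y \<in> carrier W\<rbrakk> \<Longrightarrow> \<pi> (x \<oplus>\<^bsub>W\<^esub> y) = \<pi> x \<oplus>\<^bsub>W\<^esub> \<pi> y"
    and \<pi>_smult: "\<And>a x. \<lbrakk>a \<in> carrier RG; x \<in> carrier W\<rbrakk> \<Longrightarrow> \<pi> (a \<odot>\<^bsub>W\<^esub> x) = a \<odot>\<^bsub>W\<^esub> \<pi> x"
    and \<pi>_id: "\<And>x. x \<in> H \<Longrightarrow> \<pi> x = x"
    using W.direct_summand_projection[OF H] by blast
  have H_sub: "x \<in> carrier W" if "x \<in> H" for x
    using H that by (auto simp: direct_summand_def submodule_def subgroup_def)
  obtain h where h: "h \<in> module_hom RG X (W\<lparr>carrier := H\<rparr>)" and bij: "bij_betw h (carrier X) H"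
    using iso by (auto simp: module_isomorphic_def)
  have h_closed: "h x \<in> H" if "x \<in> carrier X" for x using module_homD(2)[OF h that] by simp
  have h_add: "h (x \<oplus>\<^bsub>X\<^esub> y) = h x \<oplus>\<^bsub>W\<^esub> h y" if "x \<in> carrier X" "y \<in> carrier X" for x y
    using module_homD(3)[OF h that] by simp
  have h_smult: "h (a \<odot>\<^bsub>X\<^esub> x) = a \<odot>\<^bsub>W\<^esub> h x" if "a \<in> carrier RG" "x \<in> carrier X" for a x
    using module_homD(4)[OF h that] by simp
  have h_inj: "x = y" if "h x = h y" "x \<in> carrier X" "y \<in> carrier X" for x y
    using bij that by (auto simp: bij_betw_def inj_on_def)
  define h' where "h' = inv_into (carrier X) h"
  have h': "h' z \<in> carrier X" "h (h' z) = z" if "z \<in> H" for z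
    using bij that by (auto simp: h'_def bij_betw_def inv_into_into f_inv_into_f)
  let ?\<theta> = "\<lambda>x. h' (\<pi> (\<theta> (h x)))"
  have \<theta>'_closed: "?\<theta> x \<in> carrier X" if "x \<in> carrier X" for x
    using that by (simp add: h' \<pi> \<theta>_closed H_sub h_closed)
  have h_\<theta>': "h (?\<theta> x) = \<pi> (\<theta> (h x))" if "x \<in> carrier X" for x
    using that by (simp add: h' \<pi> \<theta>_closed H_sub h_closed)
  show thesis
  proof (rule that[of ?\<theta>])
    have "?\<theta> (x \<oplus>\<^bsub>X\<^esub> y) = ?\<theta> x \<oplus>\<^bsub>X\<^esub> ?\<theta> y" if xy: "x \<in> carrier X" "y \<in> carrier X" for x y
    proof (rule h_inj)
      have "h (?\<theta> (x \<oplus>\<^bsub>X\<^esub> y)) = \<pi> (\<theta> (h (x \<oplus>\<^bsub>X\<^esub> y)))"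
        by (rule h_\<theta>') (use xy in simp)
      also have "\<dots> = h (?\<theta> x) \<oplus>\<^bsub>W\<^esub> h (?\<theta> y)"
        using xy by (simp add: h_\<theta>' h_add \<theta>_add \<pi>_add \<theta>_closed H_sub h_closed)
      finally show "h (?\<theta> (x \<oplus>\<^bsub>X\<^esub> y)) = h (?\<theta> x \<oplus>\<^bsub>X\<^esub> ?\<theta> y)"
        using xy by (simp add: h_add \<theta>'_closed)
    qed (use xy \<theta>'_closed[of "x \<oplus>\<^bsub>X\<^esub> y"] in \<open>simp_all add: \<theta>'_closed\<close>)
    then show "?\<theta> \<in> hom (add_monoid X) (add_monoid X)"
      by (auto simp: hom_def \<theta>'_closed)
    fix x assume x: "x \<in> carrier X"
    let ?t = "\<lambda>w g. mnl \<one> g \<odot>\<^bsub>W\<^esub> \<theta> (mnl \<one> (inv\<^bsub>G\<^esub> g) \<odot>\<^bsub>W\<^esub> w)"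
    let ?s = "\<lambda>g. mnl \<one> g \<odot>\<^bsub>X\<^esub> ?\<theta> (mnl \<one> (inv\<^bsub>G\<^esub> g) \<odot>\<^bsub>X\<^esub> x)"
    have s: "?s \<in> carrier G \<rightarrow> carrier X" using x by (auto intro!: X_closed \<theta>'_closed)
    have t: "?t (h x) \<in> carrier G \<rightarrow> carrier W"
      using x by (simp add: \<theta>_closed H_sub h_closed)
    have "h (\<Oplus>\<^bsub>X\<^esub>g\<in>carrier G. ?s g) = (\<Oplus>\<^bsub>W\<^esub>g\<in>carrier G. h (?s g))"
      by (rule additive_map_finsum[OF X W.M.abelian_group_axioms])
         (use s finite_group in \<open>auto simp: hom_def h_add H_sub h_closed\<close>)
    also have "\<dots> = (\<Oplus>\<^bsub>W\<^esub>g\<in>carrier G. \<pi> (?t (h x) g))"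
      using x
      by (intro W.M.finsum_cong')
         (auto simp: h_smult h' \<pi>_smult X_closed \<theta>'_closed \<theta>_closed H_sub h_closed \<pi>)
    also have "\<dots> = \<pi> (\<Oplus>\<^bsub>W\<^esub>g\<in>carrier G. ?t (h x) g)"
      by (rule additive_map_finsum[OF W.M.abelian_group_axioms W.M.abelian_group_axioms, symmetric])
         (use t finite_group in \<open>auto simp: hom_def \<pi>_add H_sub \<pi>\<close>)
    also have "\<dots> = h x" using x by (simp add: trace H_sub h_closed \<pi>_id)
    finally show "(\<Oplus>\<^bsub>X\<^esub>g\<in>carrier G. ?s g) = x"
      by (rule h_inj) (use x s in auto)
  qed
qed

end

section \<open>The trace map from induction\<close>

context group_algebra_hom
begin

definition pullback :: "('h \<Rightarrow> 'r) \<Rightarrow> 'g \<Rightarrow> 'r"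
  where "pullback b = (\<lambda>x\<in>carrier G. b (\<phi> x))"

lemma pullback_closed [simp, intro]: "b \<in> carrier G1.RG \<Longrightarrow> pullback b \<in> carrier G.RG"
  by (auto simp: pullback_def G.carrier_RG G1.RG_eval)

lemma pullback_eval: "x \<in> carrier G \<Longrightarrow> pullback b x = b (\<phi> x)"
  by (simp add: pullback_def)

lemma pullback_add:
  "\<lbrakk>a \<in> carrier G1.RG; b \<in> carrier G1.RG\<rbrakk>
    \<Longrightarrow> pullback (a \<oplus>\<^bsub>G1.RG\<^esub> b) = pullback a \<oplus>\<^bsub>G.RG\<^esub> pullback b"
  by (rule G.RG_eqI) (auto simp: pullback_eval G.RG_add G1.RG_add G.RG_add_closed G1.RG_add_closed)

text \<open>
  Pulling back is linear over \<open>RG\<close> on both sides: it suffices to take \<open>a = r g\<close>, and multiplication by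
  \<open>g\<close> translates the argument of a function on \<open>G\<close>, while multiplication by \<open>\<phi> g\<close> translates it on \<open>G\<^sub>1\<close>.
\<close>

lemma pullback_mult_left:
  assumes "a \<in> carrier G.RG" "b \<in> carrier G1.RG"
  shows "pullback (map_RG a \<otimes>\<^bsub>G1.RG\<^esub> b) = a \<otimes>\<^bsub>G.RG\<^esub> pullback b"
  using assms(1)
proof (induction a rule: G.RG_induct)
  case (monomial r g)
  with assms(2) show ?case
    by (intro G.RG_eqI)
       (auto simp: map_RG_mnl pullback_eval G1.mnl_mult_eval G.mnl_mult_eval phi_mult phi_inv
          G.RG_mult_closed G1.RG_mult_closed)
next
  case (add a c)
  with assms(2) show ?case
    by (simp add: map_RG_add G1.RG_l_distr G.RG_l_distr pullback_add G1.RG_mult_closed)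
qed

lemma pullback_mult_right:
  assumes "a \<in> carrier G.RG" "b \<in> carrier G1.RG"
  shows "pullback (b \<otimes>\<^bsub>G1.RG\<^esub> map_RG a) = pullback b \<otimes>\<^bsub>G.RG\<^esub> a"
  using assms(1)
proof (induction a rule: G.RG_induct)
  case (monomial r g)
  with assms(2) show ?case
    by (intro G.RG_eqI)
       (auto simp: map_RG_mnl pullback_eval G1.mult_mnl_eval G.mult_mnl_eval phi_mult phi_inv
          G.RG_mult_closed G1.RG_mult_closed)
next
  case (add a c)
  with assms(2) show ?case
    by (simp add: map_RG_add G1.RG_r_distr G.RG_r_distr pullback_add G1.RG_mult_closed)
qed

abbreviation "Ker \<equiv> kernel G G\<^sub>1 \<phi>"

lemma Ker_subgroup: "subgroup Ker G"
  using group_hom.subgroup_kernel[of G G\<^sub>1 \<phi>] G.is_group G1.is_group hom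
  by (simp add: group_hom_def group_hom_axioms_def)

lemma Ker_iff: "k \<in> Ker \<longleftrightarrow> k \<in> carrier G \<and> \<phi> k = \<one>\<^bsub>G\<^sub>1\<^esub>"
  by (auto simp: kernel_def)

lemma Ker_carrier: "k \<in> Ker \<Longrightarrow> k \<in> carrier G"
  by (simp add: Ker_iff)

lemma Ker_inv: "k \<in> Ker \<Longrightarrow> inv\<^bsub>G\<^esub> k \<in> Ker"
  by (rule subgroup.m_inv_closed[OF Ker_subgroup])

lemma finite_Ker: "finite Ker"
  using G.finite_group subgroup.subset[OF Ker_subgroup] by (rule rev_finite_subset)

text \<open>
  The norm element of the kernel, which acts on a module as the trace \<open>v \<mapsto> \<Sum>\<^bsub>k \<in> K\<^esub> k v\<close>.
\<close>

lemma pullback_one: "pullback \<one>\<^bsub>G1.RG\<^esub> = (\<Oplus>\<^bsub>G.RG\<^esub>k\<in>Ker. G.mnl \<one> k)"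
proof (rule G.RG_eqI)
  interpret RG: ring G.RG by (rule G.RG_ring)
  have mons: "G.mnl \<one> \<in> Ker \<rightarrow> carrier G.RG" by auto
  then show "(\<Oplus>\<^bsub>G.RG\<^esub>k\<in>Ker. G.mnl \<one> k) \<in> carrier G.RG" by (rule RG.finsum_closed)
  show "pullback \<one>\<^bsub>G1.RG\<^esub> \<in> carrier G.RG" by (auto simp: G1.RG_one)
  fix x assume x: "x \<in> carrier G"
  have "(\<Oplus>k\<in>Ker. G.mnl \<one> k x) = (if x \<in> Ker then \<one> else \<zero>)"
  proof (cases "x \<in> Ker")
    case True
    have "(\<Oplus>k\<in>Ker. G.mnl \<one> k x) = G.mnl \<one> x x"
      by (rule G.finsum_eq_single) (use True x finite_Ker in \<open>auto simp: G.mnl_eval\<close>)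
    with True x show ?thesis by (simp add: G.mnl_eval)
  next
    case False
    have "(\<Oplus>k\<in>Ker. G.mnl \<one> k x) = \<zero>"
      by (rule G.add.finprod_one_eqI) (use False x in \<open>auto simp: G.mnl_eval\<close>)
    with False show ?thesis by simp
  qed
  then show "pullback \<one>\<^bsub>G1.RG\<^esub> x = (\<Oplus>\<^bsub>G.RG\<^esub>k\<in>Ker. G.mnl \<one> k) x"
    using x mons finite_Ker by (simp add: G.RG_finsum_eval pullback_eval G1.RG_one G1.mnl_eval Ker_iff)
qed

lemma pullback_outside:
  assumes "r \<in> carrier R" "y \<in> carrier G\<^sub>1" "y \<notin> \<phi> ` carrier G"
  shows "pullback (G1.mnl r y) = \<zero>\<^bsub>G.RG\<^esub>"
  by (rule G.RG_eqI)
     (use assms in \<open>auto simp: pullback_eval G1.mnl_eval G.RG_zero G.RG_zero_closed\<close>)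

text \<open>
  Representatives of the cosets \<open>y \<phi>(G)\<close>: choose one element from each coset.  The choice depends
  on the coset only, so a chosen element is its own representative, whence uniqueness.
\<close>

lemma ex_transversal:
  obtains T where "T \<subseteq> carrier G\<^sub>1"
    and "\<And>y. y \<in> carrier G\<^sub>1 \<Longrightarrow> \<exists>t\<in>T. \<exists>x\<in>carrier G. y = t \<otimes>\<^bsub>G\<^sub>1\<^esub> \<phi> x"
    and "\<And>s t x. \<lbrakk>s \<in> T; t \<in> T; x \<in> carrier G; s = t \<otimes>\<^bsub>G\<^sub>1\<^esub> \<phi> x\<rbrakk> \<Longrightarrow> s = t"
proof -
  define coset where "coset y = {z \<in> carrier G\<^sub>1. \<exists>x\<in>carrier G. z = y \<otimes>\<^bsub>G\<^sub>1\<^esub> \<phi> x}" for y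
  define c where "c y = (SOME z. z \<in> coset y)" for y
  have c: "c y \<in> coset y" if "y \<in> carrier G\<^sub>1" for y
  proof -
    have "y \<in> coset y" using that by (auto simp: coset_def phi_one intro!: bexI[of _ "\<one>\<^bsub>G\<^esub>"])
    then show ?thesis unfolding c_def by (rule someI)
  qed
  have coset_eq: "coset (y \<otimes>\<^bsub>G\<^sub>1\<^esub> \<phi> x) = coset y" if "y \<in> carrier G\<^sub>1" "x \<in> carrier G" for x y
  proof (intro equalityI subsetI)
    fix z assume "z \<in> coset (y \<otimes>\<^bsub>G\<^sub>1\<^esub> \<phi> x)"
    then obtain w where "z \<in> carrier G\<^sub>1" "w \<in> carrier G" "z = y \<otimes>\<^bsub>G\<^sub>1\<^esub> \<phi> x \<otimes>\<^bsub>G\<^sub>1\<^esub> \<phi> w"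
      by (auto simp: coset_def)
    with that show "z \<in> coset y"
      by (auto simp: coset_def phi_mult G1.m_assoc intro!: bexI[of _ "x \<otimes>\<^bsub>G\<^esub> w"])
  next
    fix z assume "z \<in> coset y"
    then obtain w where w: "z \<in> carrier G\<^sub>1" "w \<in> carrier G" "z = y \<otimes>\<^bsub>G\<^sub>1\<^esub> \<phi> w"
      by (auto simp: coset_def)
    have "z = y \<otimes>\<^bsub>G\<^sub>1\<^esub> \<phi> x \<otimes>\<^bsub>G\<^sub>1\<^esub> \<phi> (inv\<^bsub>G\<^esub> x \<otimes>\<^bsub>G\<^esub> w)"
      using that w
      by (simp add: phi_mult phi_inv G1.m_assoc) (simp add: G1.m_assoc[symmetric])
    with that w show "z \<in> coset (y \<otimes>\<^bsub>G\<^sub>1\<^esub> \<phi> x)"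
      by (auto simp: coset_def intro!: bexI[of _ "inv\<^bsub>G\<^esub> x \<otimes>\<^bsub>G\<^esub> w"])
  qed
  show thesis
  proof (rule that[of "c ` carrier G\<^sub>1"])
    show "c ` carrier G\<^sub>1 \<subseteq> carrier G\<^sub>1" using c by (auto simp: coset_def)
    fix y assume y: "y \<in> carrier G\<^sub>1"
    then obtain x where x: "x \<in> carrier G" "c y = y \<otimes>\<^bsub>G\<^sub>1\<^esub> \<phi> x" using c by (auto simp: coset_def)
    then have "y = c y \<otimes>\<^bsub>G\<^sub>1\<^esub> \<phi> (inv\<^bsub>G\<^esub> x)"
      using y by (simp add: phi_inv G1.m_assoc)
    with y x show "\<exists>t\<in>c ` carrier G\<^sub>1. \<exists>x\<in>carrier G. y = t \<otimes>\<^bsub>G\<^sub>1\<^esub> \<phi> x" by blast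
  next
    fix s t x assume st: "s \<in> c ` carrier G\<^sub>1" "t \<in> c ` carrier G\<^sub>1" and x: "x \<in> carrier G"
      and eq: "s = t \<otimes>\<^bsub>G\<^sub>1\<^esub> \<phi> x"
    have fixed: "c u = u \<and> u \<in> carrier G\<^sub>1" if u: "u \<in> c ` carrier G\<^sub>1" for u
    proof -
      obtain y where y: "y \<in> carrier G\<^sub>1" "u = c y" using u by blast
      have "u \<in> coset y" unfolding y(2) by (rule c[OF y(1)])
      then obtain w where w: "w \<in> carrier G" "u = y \<otimes>\<^bsub>G\<^sub>1\<^esub> \<phi> w"
        unfolding coset_def by blast
      then have "coset u = coset y" by (simp only: coset_eq[OF y(1)])
      then have "c u = c y" by (simp only: c_def)
      moreover have "u \<in> carrier G\<^sub>1" unfolding w(2) using y(1) w(1) by auto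
      ultimately show ?thesis by (simp only: y(2))
    qed
    have "coset s = coset t" unfolding eq using fixed[OF st(2)] x by (intro coset_eq) auto
    then have "c s = c t" by (simp only: c_def)
    then show "s = t" using fixed[OF st(1)] fixed[OF st(2)] by simp
  qed
qed

end

context induction
begin

abbreviation "\<delta> \<equiv> G.mnl \<one>"
abbreviation "\<delta>\<^sub>1 \<equiv> G1.mnl \<one>"

text \<open>
  The map \<open>b \<otimes> v \<mapsto> (b \<circ> \<phi>) v\<close>.  It respects the relation \<open>b \<phi>(a) \<otimes> v = b \<otimes> a v\<close> by the
  linearity of the pullback on the right, and it is \<open>RG\<close>-linear by the linearity on the left.
\<close>

definition trace_map :: "(('h \<Rightarrow> 'r) \<times> 'v \<Rightarrow>\<^sub>0 int) set \<Rightarrow> 'v"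
  where "trace_map = (SOME f. f \<in> hom (add_monoid I.TP) (add_monoid V) \<and>
    (\<forall>b\<in>carrier G1.RG. \<forall>v\<in>carrier V. f (I.tens b v) = pullback b \<odot>\<^bsub>V\<^esub> v))"

lemma trace_map_additive: "trace_map \<in> hom (add_monoid I.TP) (add_monoid V)"
  and trace_map_tens:
    "\<lbrakk>b \<in> carrier G1.RG; v \<in> carrier V\<rbrakk> \<Longrightarrow> trace_map (I.tens b v) = pullback b \<odot>\<^bsub>V\<^esub> v"
proof -
  obtain f where "f \<in> hom (add_monoid I.TP) (add_monoid V)"
    "\<And>b v. \<lbrakk>b \<in> carrier G1.RG; v \<in> carrier V\<rbrakk> \<Longrightarrow> f (I.tens b v) = pullback b \<odot>\<^bsub>V\<^esub> v"
    by (rule I.TP_universal[of V "\<lambda>b v. pullback b \<odot>\<^bsub>V\<^esub> v"])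
       (auto simp: V.abelian_group_axioms pullback_add pullback_mult_right V.smult_l_distr
          V.smult_r_distr V.smult_assoc1)
  then have "\<exists>f. f \<in> hom (add_monoid I.TP) (add_monoid V) \<and>
    (\<forall>b\<in>carrier G1.RG. \<forall>v\<in>carrier V. f (I.tens b v) = pullback b \<odot>\<^bsub>V\<^esub> v)" by blast
  note * = someI_ex[OF this, folded trace_map_def]
  from * show "trace_map \<in> hom (add_monoid I.TP) (add_monoid V)" by blast
  from * show "trace_map (I.tens b v) = pullback b \<odot>\<^bsub>V\<^esub> v"
    if "b \<in> carrier G1.RG" "v \<in> carrier V" using that by blast
qed

lemma trace_map_closed [simp, intro]: "u \<in> carrier I.TP \<Longrightarrow> trace_map u \<in> carrier V"
  using trace_map_additive by (auto simp: hom_def)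

lemma trace_map_add:
  "\<lbrakk>u \<in> carrier I.TP; w \<in> carrier I.TP\<rbrakk>
    \<Longrightarrow> trace_map (u \<oplus>\<^bsub>I.TP\<^esub> w) = trace_map u \<oplus>\<^bsub>V\<^esub> trace_map w"
  using trace_map_additive by (auto simp: hom_def)

lemma trace_map_linear:
  assumes a: "a \<in> carrier G.RG" and u: "u \<in> carrier I.TP"
  shows "trace_map (map_RG a \<odot>\<^bsub>I.TP\<^esub> u) = a \<odot>\<^bsub>V\<^esub> trace_map u"
  using u
proof (induction u rule: I.TP_induct)
  case (tens b v)
  with a show ?case
    by (simp add: I.smult_tens trace_map_tens pullback_mult_left V.smult_assoc1 map_RG_closed)
next
  case (add u w)
  with a show ?case by (simp add: I.smult_r_distr trace_map_add V.smult_r_distr map_RG_closed)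
qed

lemma trace_map_one_tens:
  assumes v: "v \<in> carrier V"
  shows "trace_map (I.tens \<one>\<^bsub>G1.RG\<^esub> v) = (\<Oplus>\<^bsub>V\<^esub>k\<in>Ker. \<delta> k \<odot>\<^bsub>V\<^esub> v)"
proof -
  have "trace_map (I.tens \<one>\<^bsub>G1.RG\<^esub> v) = (\<Oplus>\<^bsub>G.RG\<^esub>k\<in>Ker. \<delta> k) \<odot>\<^bsub>V\<^esub> v"
    using v by (simp add: trace_map_tens pullback_one)
  also have "\<dots> = (\<Oplus>\<^bsub>V\<^esub>k\<in>Ker. \<delta> k \<odot>\<^bsub>V\<^esub> v)"
    by (rule V.smult_finsum_left) (use v finite_Ker in auto)
  finally show ?thesis .
qed

lemma trace_map_outside:
  assumes "r \<in> carrier R" "y \<in> carrier G\<^sub>1" "y \<notin> \<phi> ` carrier G" "v \<in> carrier V"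
  shows "trace_map (I.tens (G1.mnl r y) v) = \<zero>\<^bsub>V\<^esub>"
  using assms by (simp add: trace_map_tens pullback_outside V.smult_zero_left)

text \<open>
  Allows to move the \<open>\<phi>(G)\<close>-part of an element of \<open>G\<^sub>1\<close> across the tensor sign.
\<close>

lemma mnl_factor:
  assumes "r \<in> carrier R" "s \<in> carrier G\<^sub>1" "x \<in> carrier G"
  shows "G1.mnl r (s \<otimes>\<^bsub>G\<^sub>1\<^esub> \<phi> x) = \<delta>\<^sub>1 s \<otimes>\<^bsub>G1.RG\<^esub> map_RG (G.mnl r x)"
  using assms by (simp add: map_RG_mnl G1.mnl_mult_mnl)

end

section \<open>Induction is right adjoint to restriction\<close>

text \<open>
  The data behind the inverse of the second isomorphism: a map \<open>\<theta>\<close> whose conjugates under the kernel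
  add up to the identity, and representatives \<open>T\<close> of the cosets \<open>y \<phi>(G)\<close> in \<open>G\<^sub>1\<close>.
\<close>

locale split_trace_induction = induction R G G\<^sub>1 \<phi> V V\<^sub>1
  for R :: "('r, 'c) ring_scheme" (structure) and G :: "('g, 'd) monoid_scheme"
    and G\<^sub>1 :: "('h, 'e) monoid_scheme" and \<phi> :: "'g \<Rightarrow> 'h"
    and V :: "('g \<Rightarrow> 'r, 'v, 'f) module_scheme"
    and V\<^sub>1 :: "('h \<Rightarrow> 'r, 'u, 'k) module_scheme" +
  fixes \<theta> :: "'v \<Rightarrow> 'v" and T :: "'h set"
  assumes \<theta>_additive: "\<theta> \<in> hom (add_monoid V) (add_monoid V)"
    and \<theta>_trace: "v \<in> carrier V \<Longrightarrow> (\<Oplus>\<^bsub>V\<^esub>k\<in>Ker. \<delta> k \<odot>\<^bsub>V\<^esub> \<theta> (\<delta> (inv\<^bsub>G\<^esub> k) \<odot>\<^bsub>V\<^esub> v)) = v"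
    and transversal_subset: "T \<subseteq> carrier G\<^sub>1"
    and transversal_exists:
      "y \<in> carrier G\<^sub>1 \<Longrightarrow> \<exists>t\<in>T. \<exists>x\<in>carrier G. y = t \<otimes>\<^bsub>G\<^sub>1\<^esub> \<phi> x"
    and transversal_unique:
      "\<lbrakk>s \<in> T; t \<in> T; x \<in> carrier G; s = t \<otimes>\<^bsub>G\<^sub>1\<^esub> \<phi> x\<rbrakk> \<Longrightarrow> s = t"
begin

lemma \<theta>_closed [simp, intro]: "v \<in> carrier V \<Longrightarrow> \<theta> v \<in> carrier V"
  using \<theta>_additive by (auto simp: hom_def)

lemma \<theta>_trace_inv:
  assumes v: "v \<in> carrier V"
  shows "(\<Oplus>\<^bsub>V\<^esub>k\<in>Ker. \<delta> (inv\<^bsub>G\<^esub> k) \<odot>\<^bsub>V\<^esub> \<theta> (\<delta> k \<odot>\<^bsub>V\<^esub> v)) = v"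
proof -
  let ?t = "\<lambda>k. \<delta> k \<odot>\<^bsub>V\<^esub> \<theta> (\<delta> (inv\<^bsub>G\<^esub> k) \<odot>\<^bsub>V\<^esub> v)"
  have inj: "inj_on (m_inv G) Ker"
    by (rule inj_onI) (metis G.inv_inv Ker_carrier)
  have img: "m_inv G ` Ker = Ker"
    using Ker_inv by (force simp: image_iff Ker_carrier)
  have "(\<Oplus>\<^bsub>V\<^esub>k\<in>m_inv G ` Ker. ?t k) = (\<Oplus>\<^bsub>V\<^esub>k\<in>Ker. ?t (inv\<^bsub>G\<^esub> k))"
    by (rule V.finsum_reindex[OF _ inj]) (use v in auto)
  also have "\<dots> = (\<Oplus>\<^bsub>V\<^esub>k\<in>Ker. \<delta> (inv\<^bsub>G\<^esub> k) \<odot>\<^bsub>V\<^esub> \<theta> (\<delta> k \<odot>\<^bsub>V\<^esub> v))"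
    by (rule V.finsum_cong') (use v in \<open>auto simp: Ker_carrier\<close>)
  finally show ?thesis using \<theta>_trace[OF v] by (simp add: img)
qed

text \<open>
  In \<open>Ind V\<close> the kernel acts trivially on the right-hand factor, \<open>s \<otimes> w = s k\<^bsup>-1\<^esup> \<otimes> w = s \<otimes> k\<^bsup>-1\<^esup> w\<close>, as \<open>\<phi>(k) = 1\<close>.
  Inserting \<open>k\<^bsup>-1\<^esup>\<close> into the summand for \<open>k\<close> of \<open>\<theta> (\<Sum>\<^bsub>k\<^esub> k v) = \<Sum>\<^bsub>k\<^esub> \<theta> (k v)\<close> turns it into a sum of conjugates.
\<close>

lemma tens_\<theta>_trace:
  assumes s: "s \<in> carrier G\<^sub>1" and v: "v \<in> carrier V"
  shows "I.tens (\<delta>\<^sub>1 s) (\<theta> (\<Oplus>\<^bsub>V\<^esub>k\<in>Ker. \<delta> k \<odot>\<^bsub>V\<^esub> v)) = I.tens (\<delta>\<^sub>1 s) v"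
proof -
  have absorb: "I.tens (\<delta>\<^sub>1 s) w = I.tens (\<delta>\<^sub>1 s) (\<delta> (inv\<^bsub>G\<^esub> k) \<odot>\<^bsub>V\<^esub> w)"
    if "k \<in> Ker" "w \<in> carrier V" for k w
  proof -
    have "\<delta>\<^sub>1 s = \<delta>\<^sub>1 s \<otimes>\<^bsub>G1.RG\<^esub> map_RG (\<delta> (inv\<^bsub>G\<^esub> k))"
      using mnl_factor[of \<one> s "inv\<^bsub>G\<^esub> k"] Ker_inv[OF that(1)] s by (simp add: Ker_iff)
    then show ?thesis using I.tens_balanced[of "\<delta>\<^sub>1 s" "\<delta> (inv\<^bsub>G\<^esub> k)" w] that by simp
  qed
  have "\<theta> (\<Oplus>\<^bsub>V\<^esub>k\<in>Ker. \<delta> k \<odot>\<^bsub>V\<^esub> v) = (\<Oplus>\<^bsub>V\<^esub>k\<in>Ker. \<theta> (\<delta> k \<odot>\<^bsub>V\<^esub> v))"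
    by (rule additive_map_finsum[OF V.abelian_group_axioms V.abelian_group_axioms \<theta>_additive finite_Ker])
       (use v in auto)
  then have "I.tens (\<delta>\<^sub>1 s) (\<theta> (\<Oplus>\<^bsub>V\<^esub>k\<in>Ker. \<delta> k \<odot>\<^bsub>V\<^esub> v))
      = (\<Oplus>\<^bsub>I.TP\<^esub>k\<in>Ker. I.tens (\<delta>\<^sub>1 s) (\<theta> (\<delta> k \<odot>\<^bsub>V\<^esub> v)))"
    using I.tens_finsum_right[of "\<delta>\<^sub>1 s" Ker "\<lambda>k. \<theta> (\<delta> k \<odot>\<^bsub>V\<^esub> v)"] v finite_Ker by auto
  also have "\<dots> = (\<Oplus>\<^bsub>I.TP\<^esub>k\<in>Ker. I.tens (\<delta>\<^sub>1 s) (\<delta> (inv\<^bsub>G\<^esub> k) \<odot>\<^bsub>V\<^esub> \<theta> (\<delta> k \<odot>\<^bsub>V\<^esub> v)))"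
    by (rule I.TP.finsum_cong') (use v absorb in auto)
  also have "\<dots> = I.tens (\<delta>\<^sub>1 s) (\<Oplus>\<^bsub>V\<^esub>k\<in>Ker. \<delta> (inv\<^bsub>G\<^esub> k) \<odot>\<^bsub>V\<^esub> \<theta> (\<delta> k \<odot>\<^bsub>V\<^esub> v))"
    by (rule I.tens_finsum_right[symmetric]) (use v finite_Ker in auto)
  finally show ?thesis by (simp add: \<theta>_trace_inv[OF v])
qed

lemma transversal_carrier [simp, intro]: "t \<in> T \<Longrightarrow> t \<in> carrier G\<^sub>1"
  using transversal_subset by blast

lemma finite_transversal: "finite T"
  using G1.finite_group transversal_subset by (rule rev_finite_subset)

text \<open>
  This makes all but one summand vanish under \<open>trace_map\<close> in the two sums over \<open>T\<close> below.
\<close>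

lemma transversal_quotient_outside:
  assumes st: "s \<in> T" "t \<in> T" "t \<noteq> s" and x: "x \<in> carrier G"
  shows "\<phi> x \<otimes>\<^bsub>G\<^sub>1\<^esub> (inv\<^bsub>G\<^sub>1\<^esub> s \<otimes>\<^bsub>G\<^sub>1\<^esub> t) \<notin> \<phi> ` carrier G"
proof
  assume "\<phi> x \<otimes>\<^bsub>G\<^sub>1\<^esub> (inv\<^bsub>G\<^sub>1\<^esub> s \<otimes>\<^bsub>G\<^sub>1\<^esub> t) \<in> \<phi> ` carrier G"
  then obtain y where y: "y \<in> carrier G" "\<phi> x \<otimes>\<^bsub>G\<^sub>1\<^esub> (inv\<^bsub>G\<^sub>1\<^esub> s \<otimes>\<^bsub>G\<^sub>1\<^esub> t) = \<phi> y" by auto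
  have "t = s \<otimes>\<^bsub>G\<^sub>1\<^esub> (inv\<^bsub>G\<^sub>1\<^esub> \<phi> x \<otimes>\<^bsub>G\<^sub>1\<^esub> (\<phi> x \<otimes>\<^bsub>G\<^sub>1\<^esub> (inv\<^bsub>G\<^sub>1\<^esub> s \<otimes>\<^bsub>G\<^sub>1\<^esub> t)))"
    using st x by (simp add: G1.m_assoc[symmetric])
  also have "\<dots> = s \<otimes>\<^bsub>G\<^sub>1\<^esub> \<phi> (inv\<^bsub>G\<^esub> x \<otimes>\<^bsub>G\<^esub> y)"
    using y x by (simp add: phi_mult phi_inv)
  finally show False using transversal_unique[of t s "inv\<^bsub>G\<^esub> x \<otimes>\<^bsub>G\<^esub> y"] st x y by simp
qed

lemma \<theta>_zero: "\<theta> \<zero>\<^bsub>V\<^esub> = \<zero>\<^bsub>V\<^esub>"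
  by (rule additive_map_zero[OF V.abelian_group_axioms V.abelian_group_axioms \<theta>_additive])

lemma tens_zero: "b \<in> carrier G1.RG \<Longrightarrow> I.tens b \<zero>\<^bsub>V\<^esub> = \<zero>\<^bsub>I.TP\<^esub>"
  by (rule additive_map_zero[OF V.abelian_group_axioms I.TP_abelian_group I.tens_right_additive])

text \<open>
  Both sides are additive in \<open>u\<close>, and \<open>Ind V\<close> is generated by elements \<open>r g \<otimes> v\<close>, hence by \<open>s \<otimes> v'\<close> with
  \<open>s\<close> in \<open>T\<close>.  For \<open>u = s \<otimes> v'\<close> the summands with \<open>t \<noteq> s\<close> vanish because \<open>t\<^bsup>-1\<^esup> s\<close> is not in \<open>\<phi>(G)\<close>, and
  the one with \<open>t = s\<close> is \<open>s \<otimes> \<theta> (\<Sum>\<^bsub>k\<^esub> k v') = s \<otimes> v'\<close>.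
\<close>

lemma reconstruction:
  assumes "u \<in> carrier I.TP"
  shows "(\<Oplus>\<^bsub>I.TP\<^esub>t\<in>T. I.tens (\<delta>\<^sub>1 t) (\<theta> (trace_map (\<delta>\<^sub>1 (inv\<^bsub>G\<^sub>1\<^esub> t) \<odot>\<^bsub>I.TP\<^esub> u)))) = u"
proof -
  let ?e = "\<lambda>u t. I.tens (\<delta>\<^sub>1 t) (\<theta> (trace_map (\<delta>\<^sub>1 (inv\<^bsub>G\<^sub>1\<^esub> t) \<odot>\<^bsub>I.TP\<^esub> u)))"
  let ?E = "\<lambda>u. \<Oplus>\<^bsub>I.TP\<^esub>t\<in>T. ?e u t"
  have \<theta>_add: "\<theta> (v \<oplus>\<^bsub>V\<^esub> w) = \<theta> v \<oplus>\<^bsub>V\<^esub> \<theta> w" if "v \<in> carrier V" "w \<in> carrier V" for v w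
    using \<theta>_additive that by (auto simp: hom_def)
  have E_add: "?E (u \<oplus>\<^bsub>I.TP\<^esub> w) = ?E u \<oplus>\<^bsub>I.TP\<^esub> ?E w" if "u \<in> carrier I.TP" "w \<in> carrier I.TP" for u w
  proof -
    have "?E (u \<oplus>\<^bsub>I.TP\<^esub> w) = (\<Oplus>\<^bsub>I.TP\<^esub>t\<in>T. ?e u t \<oplus>\<^bsub>I.TP\<^esub> ?e w t)"
      by (rule I.TP.finsum_cong')
         (use that in \<open>auto simp: I.smult_r_distr trace_map_add \<theta>_add I.tens_add_right\<close>)
    also have "\<dots> = ?E u \<oplus>\<^bsub>I.TP\<^esub> ?E w"
      by (rule I.TP.finsum_addf) (use that in auto)
    finally show ?thesis .
  qed
  from assms show "?E u = u"
  proof (induction u rule: I.TP_induct)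
    case (tens b v)
    from tens(1) show ?case
    proof (induction b rule: G1.RG_induct)
      case (monomial r g)
      \<comment> \<open>Move the \<open>\<phi>(G)\<close>-part of \<open>g\<close> into the module: \<open>r g \<otimes> v = s \<otimes> v'\<close>.\<close>
      obtain s x where s: "s \<in> T" and x: "x \<in> carrier G" and g: "g = s \<otimes>\<^bsub>G\<^sub>1\<^esub> \<phi> x"
        using transversal_exists[OF monomial(2)] by blast
      define v' where "v' = G.mnl r x \<odot>\<^bsub>V\<^esub> v"
      have v': "v' \<in> carrier V" using monomial tens(2) by (auto simp: v'_def)
      have eq: "I.tens (G1.mnl r g) v = I.tens (\<delta>\<^sub>1 s) v'"
        using monomial s x tens(2) I.tens_balanced[of "\<delta>\<^sub>1 s" "G.mnl r x" v]
        by (simp add: g mnl_factor v'_def)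
      have smult: "\<delta>\<^sub>1 (inv\<^bsub>G\<^sub>1\<^esub> t) \<odot>\<^bsub>I.TP\<^esub> I.tens (\<delta>\<^sub>1 s) v' = I.tens (\<delta>\<^sub>1 (inv\<^bsub>G\<^sub>1\<^esub> t \<otimes>\<^bsub>G\<^sub>1\<^esub> s)) v'"
        if "t \<in> T" for t
        using that s v' by (simp add: I.smult_tens G1.mnl_mult_mnl)
      have "?E (I.tens (\<delta>\<^sub>1 s) v') = ?e (I.tens (\<delta>\<^sub>1 s) v') s"
      proof (rule I.TP.finsum_eq_single[OF finite_transversal s])
        show "?e (I.tens (\<delta>\<^sub>1 s) v') s \<in> carrier I.TP" using v' by auto
        fix t assume t: "t \<in> T" "t \<noteq> s"
        have "inv\<^bsub>G\<^sub>1\<^esub> t \<otimes>\<^bsub>G\<^sub>1\<^esub> s \<notin> \<phi> ` carrier G"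
          using transversal_quotient_outside[of t s "\<one>\<^bsub>G\<^esub>"] s t by (simp add: phi_one)
        then show "?e (I.tens (\<delta>\<^sub>1 s) v') t = \<zero>\<^bsub>I.TP\<^esub>"
          using s t v' by (simp add: smult trace_map_outside \<theta>_zero tens_zero)
      qed
      also have "\<dots> = I.tens (\<delta>\<^sub>1 s) (\<theta> (trace_map (I.tens \<one>\<^bsub>G1.RG\<^esub> v')))"
        using s by (simp add: smult G1.RG_one)
      also have "\<dots> = I.tens (\<delta>\<^sub>1 s) v'"
        using s v' by (simp only: trace_map_one_tens tens_\<theta>_trace transversal_carrier)
      finally show ?case by (simp only: eq)
    next
      case (add a b)
      with tens(2) show ?case by (simp add: I.tens_add_left E_add)
    qed
  next
    case (add u w)
    then show ?case by (simp only: E_add)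
  qed
qed

lemma trace_map_nondegenerate:
  assumes u: "u \<in> carrier I.TP" and w: "w \<in> carrier I.TP"
    and eq: "\<And>c. c \<in> carrier G1.RG \<Longrightarrow> trace_map (c \<odot>\<^bsub>I.TP\<^esub> u) = trace_map (c \<odot>\<^bsub>I.TP\<^esub> w)"
  shows "u = w"
proof -
  let ?e = "\<lambda>u t. I.tens (\<delta>\<^sub>1 t) (\<theta> (trace_map (\<delta>\<^sub>1 (inv\<^bsub>G\<^sub>1\<^esub> t) \<odot>\<^bsub>I.TP\<^esub> u)))"
  have "?e u t = ?e w t" for t
    using eq[of "\<delta>\<^sub>1 (inv\<^bsub>G\<^sub>1\<^esub> t)"] by simp
  then have "(\<Oplus>\<^bsub>I.TP\<^esub>t\<in>T. ?e u t) = (\<Oplus>\<^bsub>I.TP\<^esub>t\<in>T. ?e w t)" by (simp only:)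
  then show ?thesis by (simp only: reconstruction[OF u] reconstruction[OF w])
qed

text \<open>
  The witness is \<open>\<Sum>\<^bsub>t\<^esub> t \<otimes> \<theta> (h (t\<^bsup>-1\<^esup> w))\<close>.  For \<open>c = r g\<close> only the representative \<open>s\<close> of the coset of \<open>g\<^bsup>-1\<^esup>\<close>
  contributes to \<open>\<tau> (c u)\<close>.  Writing \<open>g = \<phi>(x) s\<^bsup>-1\<^esup>\<close>, its contribution is \<open>r x\<close> applied to the trace of
  \<open>\<theta> v\<close> with \<open>v = h (s\<^bsup>-1\<^esup> w)\<close>.  That trace is \<open>v\<close>, since \<open>v\<close> is fixed by the kernel, and
  \<open>r x v = h (r \<phi>(x) s\<^bsup>-1\<^esup> w) = h (c w)\<close>.
\<close>

lemma lift_exists: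
  assumes h: "h \<in> module_hom G.RG (Res R G G\<^sub>1 \<phi> V\<^sub>1) V" and w: "w \<in> carrier V\<^sub>1"
  obtains u where "u \<in> carrier I.TP"
    and "\<And>c. c \<in> carrier G1.RG \<Longrightarrow> trace_map (c \<odot>\<^bsub>I.TP\<^esub> u) = h (c \<odot>\<^bsub>V\<^sub>1\<^esub> w)"
proof -
  note hD = module_homD[OF h, unfolded Res_simps]
  let ?e = "\<lambda>t. I.tens (\<delta>\<^sub>1 t) (\<theta> (h (\<delta>\<^sub>1 (inv\<^bsub>G\<^sub>1\<^esub> t) \<odot>\<^bsub>V\<^sub>1\<^esub> w)))"
  define u where "u = (\<Oplus>\<^bsub>I.TP\<^esub>t\<in>T. ?e t)"
  have e: "?e \<in> T \<rightarrow> carrier I.TP" using w by (auto simp: hD(2))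
  have u: "u \<in> carrier I.TP" unfolding u_def using e by (rule I.TP.finsum_closed)
  show thesis
  proof (rule that[OF u])
    fix c assume "c \<in> carrier G1.RG"
    then show "trace_map (c \<odot>\<^bsub>I.TP\<^esub> u) = h (c \<odot>\<^bsub>V\<^sub>1\<^esub> w)"
    proof (induction c rule: G1.RG_induct)
      case (monomial r g)
      obtain s x' where s: "s \<in> T" and x': "x' \<in> carrier G"
        and g': "inv\<^bsub>G\<^sub>1\<^esub> g = s \<otimes>\<^bsub>G\<^sub>1\<^esub> \<phi> x'"
        using transversal_exists[of "inv\<^bsub>G\<^sub>1\<^esub> g"] monomial(2) by auto
      define x where "x = inv\<^bsub>G\<^esub> x'"
      have x: "x \<in> carrier G" using x' by (simp add: x_def)
      have g: "g = \<phi> x \<otimes>\<^bsub>G\<^sub>1\<^esub> inv\<^bsub>G\<^sub>1\<^esub> s"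
      proof -
        have "g = inv\<^bsub>G\<^sub>1\<^esub> (s \<otimes>\<^bsub>G\<^sub>1\<^esub> \<phi> x')" using monomial(2) by (simp add: g'[symmetric])
        then show ?thesis using s x' by (simp add: G1.inv_mult_group x_def phi_inv)
      qed
      define v where "v = h (\<delta>\<^sub>1 (inv\<^bsub>G\<^sub>1\<^esub> s) \<odot>\<^bsub>V\<^sub>1\<^esub> w)"
      have v: "v \<in> carrier V" using w by (auto simp: v_def hD(2))
      \<comment> \<open>The kernel acts trivially on \<open>V\<^sub>1\<close> through \<open>\<phi>\<close>, so the values of \<open>h\<close> are invariant.\<close>
      have v_fixed: "\<delta> (inv\<^bsub>G\<^esub> k) \<odot>\<^bsub>V\<^esub> v = v" if "k \<in> Ker" for k
      proof -
        have k: "inv\<^bsub>G\<^esub> k \<in> carrier G" "\<phi> (inv\<^bsub>G\<^esub> k) = \<one>\<^bsub>G\<^sub>1\<^esub>"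
          using Ker_inv[OF that] by (simp_all add: Ker_iff)
        have "\<delta> (inv\<^bsub>G\<^esub> k) \<odot>\<^bsub>V\<^esub> v = h (\<one>\<^bsub>G1.RG\<^esub> \<odot>\<^bsub>V\<^sub>1\<^esub> (\<delta>\<^sub>1 (inv\<^bsub>G\<^sub>1\<^esub> s) \<odot>\<^bsub>V\<^sub>1\<^esub> w))"
          unfolding v_def using k w
          by (subst hD(4)[symmetric]) (auto simp: map_RG_mnl G1.RG_one)
        with w show ?thesis by (simp add: v_def)
      qed
      have trace_v: "(\<Oplus>\<^bsub>V\<^esub>k\<in>Ker. \<delta> k \<odot>\<^bsub>V\<^esub> \<theta> v) = v"
      proof -
        have "(\<Oplus>\<^bsub>V\<^esub>k\<in>Ker. \<delta> k \<odot>\<^bsub>V\<^esub> \<theta> v)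
            = (\<Oplus>\<^bsub>V\<^esub>k\<in>Ker. \<delta> k \<odot>\<^bsub>V\<^esub> \<theta> (\<delta> (inv\<^bsub>G\<^esub> k) \<odot>\<^bsub>V\<^esub> v))"
          by (rule V.finsum_cong') (use v in \<open>auto simp: v_fixed\<close>)
        with \<theta>_trace[OF v] show ?thesis by simp
      qed
      have c: "G1.mnl r g \<in> carrier G1.RG" using monomial by auto
      have "trace_map (G1.mnl r g \<odot>\<^bsub>I.TP\<^esub> u)
          = trace_map (\<Oplus>\<^bsub>I.TP\<^esub>t\<in>T. G1.mnl r g \<odot>\<^bsub>I.TP\<^esub> ?e t)"
        unfolding u_def by (simp only: I.smult_finsum_right[OF finite_transversal e c])
      also have "\<dots> = (\<Oplus>\<^bsub>V\<^esub>t\<in>T. trace_map (G1.mnl r g \<odot>\<^bsub>I.TP\<^esub> ?e t))"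
        by (rule additive_map_finsum[OF I.TP_abelian_group V.abelian_group_axioms
              trace_map_additive finite_transversal]) (use e c in auto)
      also have "\<dots> = trace_map (G1.mnl r g \<odot>\<^bsub>I.TP\<^esub> ?e s)"
      proof (rule V.finsum_eq_single[OF finite_transversal s])
        show "trace_map (G1.mnl r g \<odot>\<^bsub>I.TP\<^esub> ?e s) \<in> carrier V" using e s c by auto
        fix t assume t: "t \<in> T" "t \<noteq> s"
        have "G1.mnl r g \<odot>\<^bsub>I.TP\<^esub> ?e t
            = I.tens (G1.mnl r (\<phi> x \<otimes>\<^bsub>G\<^sub>1\<^esub> (inv\<^bsub>G\<^sub>1\<^esub> s \<otimes>\<^bsub>G\<^sub>1\<^esub> t))) (\<theta> (h (\<delta>\<^sub>1 (inv\<^bsub>G\<^sub>1\<^esub> t) \<odot>\<^bsub>V\<^sub>1\<^esub> w)))"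
          using monomial t s x w
          by (simp add: I.smult_tens hD(2) G1.mnl_mult_mnl g G1.m_assoc)
        then show "trace_map (G1.mnl r g \<odot>\<^bsub>I.TP\<^esub> ?e t) = \<zero>\<^bsub>V\<^esub>"
          using transversal_quotient_outside[OF s t x] monomial t s x w
          by (simp add: trace_map_outside hD(2))
      qed
      also have "G1.mnl r g \<odot>\<^bsub>I.TP\<^esub> ?e s = map_RG (G.mnl r x) \<odot>\<^bsub>I.TP\<^esub> I.tens \<one>\<^bsub>G1.RG\<^esub> (\<theta> v)"
        using monomial s x v
        by (simp add: I.smult_tens G1.mnl_mult_mnl g G1.m_assoc map_RG_mnl v_def)
      also have "trace_map \<dots> = G.mnl r x \<odot>\<^bsub>V\<^esub> v"
        using monomial x v by (simp add: trace_map_linear trace_map_one_tens trace_v)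
      also have "\<dots> = h (map_RG (G.mnl r x) \<odot>\<^bsub>V\<^sub>1\<^esub> (\<delta>\<^sub>1 (inv\<^bsub>G\<^sub>1\<^esub> s) \<odot>\<^bsub>V\<^sub>1\<^esub> w))"
        unfolding v_def using monomial w by (subst hD(4)) auto
      also have "\<dots> = h (G1.mnl r g \<odot>\<^bsub>V\<^sub>1\<^esub> w)"
        using monomial s x w
        by (simp add: V1.smult_assoc1[symmetric] map_RG_mnl G1.mnl_mult_mnl g)
      finally show ?case .
    next
      case (add a b)
      with u w show ?case
        by (simp add: I.smult_l_distr V1.smult_l_distr trace_map_add hD(3))
    qed
  qed
qed

text \<open>
  Injectivity and the linearity of the preimage both come from \<open>trace_map_nondegenerate\<close>; for
  instance \<open>f (a w)\<close> and \<open>a f(w)\<close> coincide since \<open>\<tau> (c f (a w)) = h (c a w) = \<tau> (c a f(w))\<close> for all \<open>c\<close>.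
\<close>

lemma Res_Ind_adjunction:
  "module_isomorphic R (hom_module G1.RG V\<^sub>1 (Ind R G G\<^sub>1 \<phi> V)) (hom_module G.RG (Res R G G\<^sub>1 \<phi> V\<^sub>1) V)"
  unfolding Ind_eq
proof (rule hom_module_isomorphicI[where \<Phi> = "\<lambda>f. \<lambda>w\<in>carrier V\<^sub>1. trace_map (f w)"], unfold Res_simps)
  fix f assume f: "f \<in> module_hom G1.RG V\<^sub>1 I.TP"
  show "(\<lambda>w\<in>carrier V\<^sub>1. trace_map (f w)) \<in> module_hom G.RG (Res R G G\<^sub>1 \<phi> V\<^sub>1) V"
    by (rule module_homI)
       (simp_all add: Res_simps module_homD(2-4)[OF f] trace_map_add trace_map_linear map_RG_closed)
  fix g assume g: "g \<in> module_hom G1.RG V\<^sub>1 I.TP"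
  show "(\<lambda>x\<in>carrier V\<^sub>1. f x \<oplus>\<^bsub>I.TP\<^esub> g x) \<in> module_hom G1.RG V\<^sub>1 I.TP"
    by (rule module_hom_add_closed[OF V1.left_module_axioms I.TP_left_module f g])
  show "(\<lambda>w\<in>carrier V\<^sub>1. trace_map ((\<lambda>x\<in>carrier V\<^sub>1. f x \<oplus>\<^bsub>I.TP\<^esub> g x) w)) w
      = (\<lambda>w\<in>carrier V\<^sub>1. trace_map (f w)) w \<oplus>\<^bsub>V\<^esub> (\<lambda>w\<in>carrier V\<^sub>1. trace_map (g w)) w"
    if "w \<in> carrier V\<^sub>1" for w
    using that by (simp add: trace_map_add module_homD(2)[OF f] module_homD(2)[OF g])
  assume eq: "(\<lambda>w\<in>carrier V\<^sub>1. trace_map (f w)) = (\<lambda>w\<in>carrier V\<^sub>1. trace_map (g w))"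
  show "f = g"
  proof (rule module_hom_eqI[OF f g])
    fix w assume w: "w \<in> carrier V\<^sub>1"
    show "f w = g w"
    proof (rule trace_map_nondegenerate)
      fix c assume c: "c \<in> carrier G1.RG"
      with w have "trace_map (f (c \<odot>\<^bsub>V\<^sub>1\<^esub> w)) = trace_map (g (c \<odot>\<^bsub>V\<^sub>1\<^esub> w))"
        using fun_cong[OF eq, of "c \<odot>\<^bsub>V\<^sub>1\<^esub> w"] by simp
      with c w show "trace_map (c \<odot>\<^bsub>I.TP\<^esub> f w) = trace_map (c \<odot>\<^bsub>I.TP\<^esub> g w)"
        by (simp add: module_homD(4)[OF f] module_homD(4)[OF g])
    qed (use w module_homD(2)[OF f] module_homD(2)[OF g] in auto)
  qed
next
  fix r f assume r: "r \<in> carrier R" and f: "f \<in> module_hom G1.RG V\<^sub>1 I.TP"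
  show "(\<lambda>x\<in>carrier V\<^sub>1. (r \<odot>\<^bsub>G1.RG\<^esub> \<one>\<^bsub>G1.RG\<^esub>) \<odot>\<^bsub>I.TP\<^esub> f x) \<in> module_hom G1.RG V\<^sub>1 I.TP"
    by (rule module_hom_smult_closed[OF V1.left_module_axioms I.TP_left_module _ _ f])
       (simp_all add: r G1.scalar_one G1.scalar_central)
  have scalar: "r \<odot>\<^bsub>G1.RG\<^esub> \<one>\<^bsub>G1.RG\<^esub> = map_RG (r \<odot>\<^bsub>G.RG\<^esub> \<one>\<^bsub>G.RG\<^esub>)"
    using r by (simp add: G.scalar_one G1.scalar_one map_RG_mnl phi_one)
  show "(\<lambda>w\<in>carrier V\<^sub>1. trace_map ((\<lambda>x\<in>carrier V\<^sub>1. (r \<odot>\<^bsub>G1.RG\<^esub> \<one>\<^bsub>G1.RG\<^esub>) \<odot>\<^bsub>I.TP\<^esub> f x) w)) w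
      = (r \<odot>\<^bsub>G.RG\<^esub> \<one>\<^bsub>G.RG\<^esub>) \<odot>\<^bsub>V\<^esub> (\<lambda>w\<in>carrier V\<^sub>1. trace_map (f w)) w"
    if "w \<in> carrier V\<^sub>1" for w
    using that r module_homD(2)[OF f that] by (simp add: scalar trace_map_linear)
next
  fix h assume h: "h \<in> module_hom G.RG (Res R G G\<^sub>1 \<phi> V\<^sub>1) V"
  define f where "f = (\<lambda>w\<in>carrier V\<^sub>1. SOME u. u \<in> carrier I.TP \<and>
    (\<forall>c\<in>carrier G1.RG. trace_map (c \<odot>\<^bsub>I.TP\<^esub> u) = h (c \<odot>\<^bsub>V\<^sub>1\<^esub> w)))"
  have f: "f w \<in> carrier I.TP \<and> (\<forall>c\<in>carrier G1.RG. trace_map (c \<odot>\<^bsub>I.TP\<^esub> f w) = h (c \<odot>\<^bsub>V\<^sub>1\<^esub> w))"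
    if w: "w \<in> carrier V\<^sub>1" for w
  proof -
    have "\<exists>u. u \<in> carrier I.TP \<and> (\<forall>c\<in>carrier G1.RG. trace_map (c \<odot>\<^bsub>I.TP\<^esub> u) = h (c \<odot>\<^bsub>V\<^sub>1\<^esub> w))"
      using lift_exists[OF h w] by metis
    from someI_ex[OF this] w show ?thesis by (simp add: f_def)
  qed
  then have f_closed: "f w \<in> carrier I.TP" if "w \<in> carrier V\<^sub>1" for w using that by blast
  have f_trace: "trace_map (c \<odot>\<^bsub>I.TP\<^esub> f w) = h (c \<odot>\<^bsub>V\<^sub>1\<^esub> w)"
    if "w \<in> carrier V\<^sub>1" "c \<in> carrier G1.RG" for c w using f that by blast
  note hD = module_homD[OF h, unfolded Res_simps]
  have "f \<in> module_hom G1.RG V\<^sub>1 I.TP"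
  proof (rule module_homI)
    show "f \<in> carrier V\<^sub>1 \<rightarrow>\<^sub>E carrier I.TP"
      using f_closed by (auto simp: f_def)
    fix w z assume wz: "w \<in> carrier V\<^sub>1" "z \<in> carrier V\<^sub>1"
    show "f (w \<oplus>\<^bsub>V\<^sub>1\<^esub> z) = f w \<oplus>\<^bsub>I.TP\<^esub> f z"
      by (rule trace_map_nondegenerate)
         (use wz in \<open>simp_all add: f_closed f_trace I.smult_r_distr V1.smult_r_distr trace_map_add hD(3)\<close>)
  next
    fix a w assume aw: "a \<in> carrier G1.RG" "w \<in> carrier V\<^sub>1"
    show "f (a \<odot>\<^bsub>V\<^sub>1\<^esub> w) = a \<odot>\<^bsub>I.TP\<^esub> f w"
      by (rule trace_map_nondegenerate)
         (use aw in \<open>simp_all add: f_closed f_trace I.smult_assoc1[symmetric] V1.smult_assoc1[symmetric]\<close>)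
  qed
  moreover have "(\<lambda>w\<in>carrier V\<^sub>1. trace_map (f w)) = h"
  proof (rule PiE_ext[OF _ hD(1)])
    show "(\<lambda>w\<in>carrier V\<^sub>1. trace_map (f w)) \<in> carrier V\<^sub>1 \<rightarrow>\<^sub>E carrier V" using f_closed by auto
    show "(\<lambda>w\<in>carrier V\<^sub>1. trace_map (f w)) w = h w" if "w \<in> carrier V\<^sub>1" for w
      using f_trace[OF that, of "\<one>\<^bsub>G1.RG\<^esub>"] f_closed[OF that] that by simp
  qed
  ultimately show "\<exists>f\<in>module_hom G1.RG V\<^sub>1 I.TP. (\<lambda>w\<in>carrier V\<^sub>1. trace_map (f w)) = h" by blast
qed

end

text \<open>
  The restriction to the kernel has the same additive group as \<open>V\<close>, and a group element \<open>k\<close> of the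
  kernel acts on it as on \<open>V\<close>; so the section of the trace found there serves for \<open>V\<close>.
\<close>

lemma (in induction) Res_subgroup_trace_section:
  assumes "relatively_1_projective TYPE('w) R (G\<lparr>carrier := Ker\<rparr>) (Res_subgroup R G Ker V)"
  obtains \<theta> T where "split_trace_induction R G G\<^sub>1 \<phi> V V\<^sub>1 \<theta> T"
proof -
  let ?K = "G\<lparr>carrier := Ker\<rparr>" and ?X = "Res_subgroup R G Ker V"
  interpret K: finite_group_algebra R ?K
    using G.cring_axioms G.subgroup_imp_group[OF Ker_subgroup] finite_Ker
    by (simp add: finite_group_algebra_def finite_group_algebra_axioms_def)
  interpret incl: group_algebra_hom R ?K G "\<lambda>x. x"
    by unfold_locales (auto simp: hom_def Ker_carrier)
  have X: "carrier ?X = carrier V" "add ?X = add V" "\<zero>\<^bsub>?X\<^esub> = \<zero>\<^bsub>V\<^esub>"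
    "\<And>a x. a \<odot>\<^bsub>?X\<^esub> x = incl.map_RG a \<odot>\<^bsub>V\<^esub> x"
    by (simp_all add: Res_def)
  have X_group: "abelian_group ?X"
    by (rule abelian_groupI; unfold X) (use V.M.add.l_inv_ex in \<open>simp_all add: V.M.a_ac\<close>)
  obtain \<theta> where \<theta>: "\<theta> \<in> hom (add_monoid ?X) (add_monoid ?X)"
    and trace: "\<And>x. x \<in> carrier ?X
      \<Longrightarrow> (\<Oplus>\<^bsub>?X\<^esub>g\<in>carrier ?K. K.mnl \<one> g \<odot>\<^bsub>?X\<^esub> \<theta> (K.mnl \<one> (inv\<^bsub>?K\<^esub> g) \<odot>\<^bsub>?X\<^esub> x)) = x"
    by (rule K.relatively_1_projective_trace_section[OF X_group _ assms])
       (simp_all add: X incl.map_RG_closed)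
  have \<theta>V: "\<theta> \<in> hom (add_monoid V) (add_monoid V)" using \<theta> by (simp add: hom_def X)
  then have \<theta>_closed: "\<theta> v \<in> carrier V" if "v \<in> carrier V" for v using that by (auto simp: hom_def)
  have inv: "inv\<^bsub>?K\<^esub> k = inv\<^bsub>G\<^esub> k" if "k \<in> Ker" for k
    by (rule G.m_inv_consistent[OF Ker_subgroup that])
  have "(\<Oplus>\<^bsub>V\<^esub>k\<in>Ker. \<delta> k \<odot>\<^bsub>V\<^esub> \<theta> (\<delta> (inv\<^bsub>G\<^esub> k) \<odot>\<^bsub>V\<^esub> v)) = v" if v: "v \<in> carrier V" for v
  proof -
    let ?s = "\<lambda>g. K.mnl \<one> g \<odot>\<^bsub>?X\<^esub> \<theta> (K.mnl \<one> (inv\<^bsub>?K\<^esub> g) \<odot>\<^bsub>?X\<^esub> v)"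
    have s: "?s k = \<delta> k \<odot>\<^bsub>V\<^esub> \<theta> (\<delta> (inv\<^bsub>G\<^esub> k) \<odot>\<^bsub>V\<^esub> v)" if "k \<in> Ker" for k
      using that Ker_inv[OF that] by (simp add: X inv incl.map_RG_mnl)
    have "(\<Oplus>\<^bsub>?X\<^esub>k\<in>Ker. ?s k) = (\<Oplus>\<^bsub>V\<^esub>k\<in>Ker. ?s k)"
      using additive_map_finsum[OF X_group V.M.abelian_group_axioms, of "\<lambda>x. x" Ker ?s] finite_Ker v
      by (auto simp: hom_def X s \<theta>_closed)
    also have "\<dots> = (\<Oplus>\<^bsub>V\<^esub>k\<in>Ker. \<delta> k \<odot>\<^bsub>V\<^esub> \<theta> (\<delta> (inv\<^bsub>G\<^esub> k) \<odot>\<^bsub>V\<^esub> v))"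
      by (rule V.M.finsum_cong') (use v in \<open>auto simp: s \<theta>_closed\<close>)
    finally show ?thesis using trace[of v] v by (simp add: X)
  qed
  moreover obtain T where "T \<subseteq> carrier G\<^sub>1"
    and "\<And>y. y \<in> carrier G\<^sub>1 \<Longrightarrow> \<exists>t\<in>T. \<exists>x\<in>carrier G. y = t \<otimes>\<^bsub>G\<^sub>1\<^esub> \<phi> x"
    and "\<And>s t x. \<lbrakk>s \<in> T; t \<in> T; x \<in> carrier G; s = t \<otimes>\<^bsub>G\<^sub>1\<^esub> \<phi> x\<rbrakk> \<Longrightarrow> s = t"
    by (rule ex_transversal) (rule that)
  ultimately have "split_trace_induction R G G\<^sub>1 \<phi> V V\<^sub>1 \<theta> T"
    using \<theta>V by unfold_locales
  then show thesis by (rule that)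
qed

theorem theorem3p5:
  fixes R :: "('r, 'c) ring_scheme"
    and G :: "('g, 'd) monoid_scheme"
    and G\<^sub>1 :: "('h, 'e) monoid_scheme"
    and \<phi> :: "'g \<Rightarrow> 'h"
    and K :: "'g set"
    and V :: "('g \<Rightarrow> 'r, 'v, 'f) module_scheme"
    and V\<^sub>1 :: "('h \<Rightarrow> 'r, 'u, 'k) module_scheme"
  assumes "cring R"
    and "group G" and "finite (carrier G)"
    and "group G\<^sub>1" and "finite (carrier G\<^sub>1)"
    and "\<phi> \<in> hom G G\<^sub>1"
    and "K = kernel G G\<^sub>1 \<phi>"
    and "left_module (group_ring R G) V"
    and "left_module (group_ring R G\<^sub>1) V\<^sub>1"
  shows
    "module_isomorphic R
       (hom_module (group_ring R G\<^sub>1) (Ind R G G\<^sub>1 \<phi> V) V\<^sub>1)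
       (hom_module (group_ring R G) V (Res R G G\<^sub>1 \<phi> V\<^sub>1))
     \<and>
     (relatively_1_projective TYPE('w) R (G\<lparr>carrier := K\<rparr>) (Res_subgroup R G K V) \<longrightarrow>
      module_isomorphic R
        (hom_module (group_ring R G\<^sub>1) V\<^sub>1 (Ind R G G\<^sub>1 \<phi> V))
        (hom_module (group_ring R G) (Res R G G\<^sub>1 \<phi> V\<^sub>1) V))"
proof -
  interpret induction R G G\<^sub>1 \<phi> V V\<^sub>1
    using assms
    by (simp add: induction_def group_algebra_hom_def group_algebra_hom_axioms_def
        finite_group_algebra_def finite_group_algebra_axioms_def)
  show ?thesis
  proof (intro conjI impI)
    show "module_isomorphic R (hom_module (group_ring R G\<^sub>1) (Ind R G G\<^sub>1 \<phi> V) V\<^sub>1)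
       (hom_module (group_ring R G) V (Res R G G\<^sub>1 \<phi> V\<^sub>1))"
      by (rule Ind_Res_adjunction)
  next
    assume proj: "relatively_1_projective TYPE('w) R (G\<lparr>carrier := K\<rparr>) (Res_subgroup R G K V)"
    obtain \<theta> T where "split_trace_induction R G G\<^sub>1 \<phi> V V\<^sub>1 \<theta> T"
      by (rule Res_subgroup_trace_section[OF proj[unfolded assms(7)]])
    then show "module_isomorphic R (hom_module (group_ring R G\<^sub>1) V\<^sub>1 (Ind R G G\<^sub>1 \<phi> V))
        (hom_module (group_ring R G) (Res R G G\<^sub>1 \<phi> V\<^sub>1) V)"
      by (rule split_trace_induction.Res_Ind_adjunction)
  qed
qed

end
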